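(* Let $\mathbf{B}=\{b_0,b_1,b_2\}$ be the standard basis of adjacency matrices of the association scheme of the generalized quadrangle graph $GQ(2,1)$, i.e. the distance-regular graph on $9$ vertices with intersection array $[4,2;1,2]$ (the $3\times 3$ rook's graph), where $b_0=I_9$, $b_1$ is its adjacency matrix and $b_2$ its distance-$2$ matrix. Let $\mathbb{Z}GQ(2,1)=\mathbb{Z}b_0+\mathbb{Z}b_1+\mathbb{Z}b_2$ be its integral adjacency algebra. Then $$\zeta_{\mathbb{Z}GQ(2,1)}(s)=\left(3^{3-6s}-2\cdot 3^{2-5s}+4\cdot 3^{1-4s}+3^{1-3s}+4\cdot 3^{-2s}-2\cdot 3^{-s}+1\right)\zeta_{\mathbb{Z}}(s)^3.$$
   Context: For a commutative ring $R$ that is a free $\mathbb{Z}$-module of finite rank, Solomon's zeta function is $\zeta_R(s)=\sum_{n\ge1}a_n n^{-s}$, where $a_n$ is the number of ideals of $R$ (equivalently $R$-submodules of the regular module) of index $n$. $\zeta_{\mathbb{Z}}$ denotes the Riemann zeta function. *)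

theory Defs
  imports
    "HOL-Analysis.Analysis"
    "HOL-Algebra.QuotRing"
    "Jordan_Normal_Form.Matrix"
begin

text \<open>The order of the quotient ring is the index of the ideal; as \<open>card\<close> of an infinite set is
  \<open>0\<close>, for \<open>n \<ge> 1\<close> only ideals of finite index are counted.\<close>

definition ideal_count :: "('a, 'b) ring_scheme \<Rightarrow> nat \<Rightarrow> nat" where
  "ideal_count R n = card {I. ideal I R \<and> order (R Quot I) = n}"

text \<open>A Dirichlet series \<open>\<Sum>\<^sub>n\<^sub>\<ge>\<^sub>1 a\<^sub>n n\<^sup>-\<^sup>s\<close> is summed over \<open>Suc n\<close>, so that it starts at \<open>1\<close>.\<close>

definition solomon_term :: "('a, 'b) ring_scheme \<Rightarrow> complex \<Rightarrow> nat \<Rightarrow> complex" where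
  "solomon_term R s n = of_nat (ideal_count R (Suc n)) * of_nat (Suc n) powr (- s)"

definition solomon_zeta :: "('a, 'b) ring_scheme \<Rightarrow> complex \<Rightarrow> complex" where
  "solomon_zeta R s = (\<Sum>n. solomon_term R s n)"

text \<open>The Riemann zeta function on its half-plane of convergence \<open>Re s > 1\<close>.\<close>

definition riemann_zeta :: "complex \<Rightarrow> complex" where
  "riemann_zeta s = (\<Sum>n. of_nat (Suc n) powr (- s))"

definition at_distance :: "('v \<times> 'v) set \<Rightarrow> nat \<Rightarrow> 'v \<Rightarrow> 'v \<Rightarrow> bool" where
  "at_distance E k u v \<longleftrightarrow> (u, v) \<in> E ^^ k \<and> (\<forall>j<k. (u, v) \<notin> E ^^ j)"

definition distance_mat :: "nat \<Rightarrow> (nat \<times> nat) set \<Rightarrow> nat \<Rightarrow> int mat" where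
  "distance_mat n E k = mat n n (\<lambda>(u, v). if at_distance E k u v then 1 else 0)"

text \<open>The \<open>3 \<times> 3\<close> rook's graph: vertex \<open>u < 9\<close> is the cell in row \<open>u div 3\<close> and column \<open>u mod 3\<close>.\<close>

definition gq21_edges :: "(nat \<times> nat) set" where
  "gq21_edges = {(u, v). u < 9 \<and> v < 9 \<and> u \<noteq> v \<and> (u div 3 = v div 3 \<or> u mod 3 = v mod 3)}"

definition gq21_basis :: "nat \<Rightarrow> int mat" where
  "gq21_basis = distance_mat 9 gq21_edges"

definition ZGQ21 :: "int mat ring" where
  "ZGQ21 = (ring_mat TYPE(int) 9 ())
     \<lparr>carrier := {x \<cdot>\<^sub>m gq21_basis 0 + y \<cdot>\<^sub>m gq21_basis 1 + z \<cdot>\<^sub>m gq21_basis 2 | x y z. True}\<rparr>"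

lemma at_distance_0: "at_distance E 0 u v \<longleftrightarrow> u = v"
  by (auto simp: at_distance_def)

lemma at_distance_1: "at_distance E 1 u v \<longleftrightarrow> (u, v) \<in> E \<and> u \<noteq> v"
  by (auto simp: at_distance_def)

lemma at_distance_2: "at_distance E 2 u v \<longleftrightarrow> (u, v) \<in> E O E \<and> (u, v) \<notin> E \<and> u \<noteq> v"
  by (auto simp: at_distance_def numeral_2_eq_2 less_Suc_eq)

lemma gq21_distance_1:
  "at_distance gq21_edges 1 u v \<longleftrightarrow> (u, v) \<in> gq21_edges"
  by (auto simp: at_distance_1 gq21_edges_def simp del: One_nat_def)

lemma gq21_distance_2:
  "at_distance gq21_edges 2 u v \<longleftrightarrow> u < 9 \<and> v < 9 \<and> u div 3 \<noteq> v div 3 \<and> u mod 3 \<noteq> v mod 3"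
  (is "?l \<longleftrightarrow> ?r")
proof
  assume ?l
  then show ?r
    by (auto simp: at_distance_2 gq21_edges_def)
next
  assume r: ?r
  define w where "w = 3 * (u div 3) + v mod 3"
  have w: "w div 3 = u div 3" "w mod 3 = v mod 3"
    by (auto simp: w_def)
  have "u div 3 < 3" "v mod 3 < 3" using r by (simp_all add: less_mult_imp_div_less)
  then have "w < 9" unfolding w_def by linarith
  with r w have "(u, w) \<in> gq21_edges" "(w, v) \<in> gq21_edges"
    by (auto simp: gq21_edges_def)
  with r show ?l
    by (auto simp: at_distance_2 gq21_edges_def)
qed

lemma gq21_numbers:
  fixes a b :: "nat \<Rightarrow> nat \<Rightarrow> bool"
  defines "a \<equiv> \<lambda>u v. u \<noteq> v \<and> (u div 3 = v div 3 \<or> u mod 3 = v mod 3)"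
    and "b \<equiv> \<lambda>u v. u div 3 \<noteq> v div 3 \<and> u mod 3 \<noteq> v mod 3"
  assumes "u < 9" "v < 9"
  shows "card {w. w < 9 \<and> a u w \<and> a w v} = (if u = v then 4 else if a u v then 1 else 2)"
    and "card {w. w < 9 \<and> a u w \<and> b w v} = (if u = v then 0 else 2)"
    and "card {w. w < 9 \<and> b u w \<and> a w v} = (if u = v then 0 else 2)"
    and "card {w. w < 9 \<and> b u w \<and> b w v} = (if u = v then 4 else if a u v then 2 else 1)"
proof -
  define i j k l where ij: "i = u div 3" "j = u mod 3" "k = v div 3" "l = v mod 3"
  have sum9: "(\<Sum>w<9. f w) = f 0 + f 1 + f 2 + f 3 + f 4 + f 5 + f 6 + f 7 + f 8"
    for f :: "nat \<Rightarrow> nat"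
    by (simp add: eval_nat_numeral)
  have card9: "card {w. w < (9::nat) \<and> P (w div 3) (w mod 3)} =
    of_bool (P 0 0) + of_bool (P 0 1) + of_bool (P 0 2) + of_bool (P 1 0) + of_bool (P 1 1) +
    of_bool (P 1 2) + of_bool (P 2 0) + of_bool (P 2 1) + of_bool (P 2 2)" for P
  proof -
    have "card {w. w < (9::nat) \<and> P (w div 3) (w mod 3)} = (\<Sum>w<9. of_bool (P (w div 3) (w mod 3)))"
      by (simp add: sum.If_cases of_bool_def Int_def)
    moreover have "4 div 3 = (1::nat)" "5 div 3 = (1::nat)" "6 div 3 = (2::nat)" "7 div 3 = (2::nat)"
      "8 div 3 = (2::nat)" "4 mod 3 = (1::nat)" "5 mod 3 = (2::nat)" "7 mod 3 = (1::nat)" "8 mod 3 = (2::nat)"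
      "0 div 3 = (0::nat)" "1 div 3 = (0::nat)" "2 div 3 = (0::nat)" "3 div 3 = (1::nat)"
      "0 mod 3 = (0::nat)" "1 mod 3 = (1::nat)" "2 mod 3 = (2::nat)" "3 mod 3 = (0::nat)" "6 mod 3 = (0::nat)"
      by simp_all
    ultimately show ?thesis by (simp only: sum9)
  qed
  have ne: "u \<noteq> v \<longleftrightarrow> u div 3 \<noteq> v div 3 \<or> u mod 3 \<noteq> v mod 3" for u v :: nat
    by (metis div_mult_mod_eq)
  have a: "a = (\<lambda>u v. (u div 3 = v div 3) \<noteq> (u mod 3 = v mod 3))"
    unfolding a_def by (intro ext) (use ne in blast)
  have eq: "u = v \<longleftrightarrow> i = k \<and> j = l"
    unfolding ij using ne by blast
  have "i < 3" "j < 3" "k < 3" "l < 3"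
    using assms(3,4) unfolding ij by simp_all
  then have cases: "i = 0 \<or> i = 1 \<or> i = 2" "j = 0 \<or> j = 1 \<or> j = 2" "k = 0 \<or> k = 1 \<or> k = 2" "l = 0 \<or> l = 1 \<or> l = 2"
    by linarith+
  show "card {w. w < 9 \<and> a u w \<and> a w v} = (if u = v then 4 else if a u v then 1 else 2)"
    unfolding a eq ij[symmetric] card9[of "\<lambda>p q. ((i = p) \<noteq> (j = q)) \<and> ((p = k) \<noteq> (q = l))"]
    using cases by (elim disjE) simp_all
  show "card {w. w < 9 \<and> a u w \<and> b w v} = (if u = v then 0 else 2)"
    unfolding a b_def eq ij[symmetric] card9[of "\<lambda>p q. ((i = p) \<noteq> (j = q)) \<and> (p \<noteq> k \<and> q \<noteq> l)"]
    using cases by (elim disjE) simp_all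
  show "card {w. w < 9 \<and> b u w \<and> a w v} = (if u = v then 0 else 2)"
    unfolding a b_def eq ij[symmetric] card9[of "\<lambda>p q. (i \<noteq> p \<and> j \<noteq> q) \<and> ((p = k) \<noteq> (q = l))"]
    using cases by (elim disjE) simp_all
  show "card {w. w < 9 \<and> b u w \<and> b w v} = (if u = v then 4 else if a u v then 2 else 1)"
    unfolding a b_def eq ij[symmetric] card9[of "\<lambda>p q. (i \<noteq> p \<and> j \<noteq> q) \<and> (p \<noteq> k \<and> q \<noteq> l)"]
    using cases by (elim disjE) simp_all
qed

text \<open>The graph has diameter \<open>2\<close> and intersection array \<open>[4,2;1,2]\<close>.\<close>

lemma gq21_diameter:
  assumes "u < 9" "v < 9"
  shows "at_distance gq21_edges 0 u v \<or> at_distance gq21_edges 1 u v \<or> at_distance gq21_edges 2 u v"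
  unfolding at_distance_0 gq21_distance_1 gq21_distance_2
  using assms unfolding gq21_edges_def by blast

lemma gq21_intersection_array:
  assumes "u < 9" "v < 9"
  defines "N \<equiv> \<lambda>k. card {w. w < 9 \<and> at_distance gq21_edges k u w \<and> (w, v) \<in> gq21_edges}"
  shows "at_distance gq21_edges 0 u v \<Longrightarrow> N 1 = 4"
    and "at_distance gq21_edges 1 u v \<Longrightarrow> N 2 = 2 \<and> N 0 = 1"
    and "at_distance gq21_edges 2 u v \<Longrightarrow> N 1 = 2"
proof -
  let ?a = "\<lambda>u v::nat. u \<noteq> v \<and> (u div 3 = v div 3 \<or> u mod 3 = v mod 3)"
  let ?b = "\<lambda>u v::nat. u div 3 \<noteq> v div 3 \<and> u mod 3 \<noteq> v mod 3"
  have a: "(u, v) \<in> gq21_edges \<longleftrightarrow> ?a u v" if "u < 9" "v < 9" for u v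
    using that by (simp add: gq21_edges_def)
  have N1: "N 1 = card {w. w < 9 \<and> ?a u w \<and> ?a w v}"
    unfolding N_def gq21_distance_1 using assms(1,2)
    by (intro arg_cong[where f = card] Collect_cong conj_cong refl a)
  have N2: "N 2 = card {w. w < 9 \<and> ?b u w \<and> ?a w v}"
    unfolding N_def gq21_distance_2 using assms(1,2)
    by (intro arg_cong[where f = card] Collect_cong) (auto simp: a)
  show "at_distance gq21_edges 0 u v \<Longrightarrow> N 1 = 4"
    unfolding N1 gq21_numbers(1)[OF assms(1,2)] at_distance_0 by simp
  show "at_distance gq21_edges 2 u v \<Longrightarrow> N 1 = 2"
    unfolding N1 gq21_numbers(1)[OF assms(1,2)] gq21_distance_2 by auto
  assume uv: "at_distance gq21_edges 1 u v"
  then have ne: "u \<noteq> v" and e: "(u, v) \<in> gq21_edges"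
    unfolding gq21_distance_1 by (auto simp: gq21_edges_def)
  have "{w. w < 9 \<and> at_distance gq21_edges 0 u w \<and> (w, v) \<in> gq21_edges} = {u}"
    using e assms(1) by (auto simp: at_distance_0)
  then have "N 0 = 1" by (simp add: N_def)
  then show "N 2 = 2 \<and> N 0 = 1"
    unfolding N2 gq21_numbers(3)[OF assms(1,2)] using ne by simp
qed

lemma gq21_basis_carrier [simp]: "gq21_basis k \<in> carrier_mat 9 9"
  by (simp add: gq21_basis_def distance_mat_def)

lemma gq21_basis_dim [simp]: "dim_row (gq21_basis k) = 9" "dim_col (gq21_basis k) = 9"
  by (simp_all add: gq21_basis_def distance_mat_def)

lemma gq21_basis_entry:
  "u < 9 \<Longrightarrow> v < 9 \<Longrightarrow> gq21_basis k $$ (u, v) = of_bool (at_distance gq21_edges k u v)"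
  by (simp add: gq21_basis_def distance_mat_def)

lemma gq21_basis_0: "gq21_basis 0 = 1\<^sub>m 9"
  by (rule eq_matI) (auto simp: gq21_basis_entry at_distance_0)

lemma gq21_basis_1: "gq21_basis 1 = mat 9 9 (\<lambda>(u, v). of_bool ((u, v) \<in> gq21_edges))"
  by (rule eq_matI) (simp_all add: gq21_basis_entry gq21_distance_1 del: One_nat_def)

lemma gq21_basis_mult_entry:
  assumes "u < 9" "v < 9"
  shows "(gq21_basis k * gq21_basis l) $$ (u, v) =
    int (card {w. w < 9 \<and> at_distance gq21_edges k u w \<and> at_distance gq21_edges l w v})"
proof -
  have card: "(\<Sum>w<9. of_bool (P w)) = int (card {w. w < 9 \<and> P w})" for P :: "nat \<Rightarrow> bool"
    by (simp add: sum.If_cases of_bool_def Int_def)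
  have "(gq21_basis k * gq21_basis l) $$ (u, v) =
      (\<Sum>w<9. of_bool (at_distance gq21_edges k u w \<and> at_distance gq21_edges l w v))"
    using assms
    by (simp add: scalar_prod_def gq21_basis_entry lessThan_atLeast0 of_bool_conj del: sum_mult_of_bool_eq sum_of_bool_mult_eq)
  then show ?thesis unfolding card .
qed

lemma gq21_basis_mult:
  shows "gq21_basis 1 * gq21_basis 1 = 4 \<cdot>\<^sub>m gq21_basis 0 + 1 \<cdot>\<^sub>m gq21_basis 1 + 2 \<cdot>\<^sub>m gq21_basis 2"
    and "gq21_basis 1 * gq21_basis 2 = 0 \<cdot>\<^sub>m gq21_basis 0 + 2 \<cdot>\<^sub>m gq21_basis 1 + 2 \<cdot>\<^sub>m gq21_basis 2"
    and "gq21_basis 2 * gq21_basis 1 = 0 \<cdot>\<^sub>m gq21_basis 0 + 2 \<cdot>\<^sub>m gq21_basis 1 + 2 \<cdot>\<^sub>m gq21_basis 2"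
    and "gq21_basis 2 * gq21_basis 2 = 4 \<cdot>\<^sub>m gq21_basis 0 + 2 \<cdot>\<^sub>m gq21_basis 1 + 1 \<cdot>\<^sub>m gq21_basis 2"
proof -
  let ?a = "\<lambda>u v::nat. u \<noteq> v \<and> (u div 3 = v div 3 \<or> u mod 3 = v mod 3)"
  let ?b = "\<lambda>u v::nat. u div 3 \<noteq> v div 3 \<and> u mod 3 \<noteq> v mod 3"
  have 1: "at_distance gq21_edges 1 u v \<longleftrightarrow> ?a u v" if "u < 9" "v < 9" for u v
    using that unfolding gq21_distance_1 by (simp add: gq21_edges_def)
  have 2: "at_distance gq21_edges 2 u v \<longleftrightarrow> ?b u v" if "u < 9" "v < 9" for u v
    using that unfolding gq21_distance_2 by simp
  have ent: "(gq21_basis k * gq21_basis l) $$ (u, v) = int (card {w. w < 9 \<and> P u w \<and> Q w v})"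
    if "\<And>u v. u < 9 \<Longrightarrow> v < 9 \<Longrightarrow> at_distance gq21_edges k u v \<longleftrightarrow> P u v"
      "\<And>u v. u < 9 \<Longrightarrow> v < 9 \<Longrightarrow> at_distance gq21_edges l u v \<longleftrightarrow> Q u v" "u < 9" "v < 9"
    for k l P Q u v
    unfolding gq21_basis_mult_entry[OF that(3,4)]
    by (intro arg_cong[where f = "\<lambda>A. int (card A)"] Collect_cong conj_cong refl that) auto
  have lin: "(x \<cdot>\<^sub>m gq21_basis 0 + y \<cdot>\<^sub>m gq21_basis 1 + z \<cdot>\<^sub>m gq21_basis 2) $$ (u, v) =
      (if u = v then x else if ?a u v then y else z)" if "u < 9" "v < 9" for u v and x y z :: int
    using that 1[OF that] 2[OF that]
    by (auto simp: gq21_basis_entry at_distance_0 simp del: One_nat_def)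
  have eq: "gq21_basis k * gq21_basis l = x \<cdot>\<^sub>m gq21_basis 0 + y \<cdot>\<^sub>m gq21_basis 1 + z \<cdot>\<^sub>m gq21_basis 2"
    if "\<And>u v. u < 9 \<Longrightarrow> v < 9 \<Longrightarrow> (gq21_basis k * gq21_basis l) $$ (u, v) =
      (if u = v then x else if ?a u v then y else z)" for k l x y z
  proof (rule eq_matI)
    fix u v
    assume "u < dim_row (x \<cdot>\<^sub>m gq21_basis 0 + y \<cdot>\<^sub>m gq21_basis 1 + z \<cdot>\<^sub>m gq21_basis 2)"
      and "v < dim_col (x \<cdot>\<^sub>m gq21_basis 0 + y \<cdot>\<^sub>m gq21_basis 1 + z \<cdot>\<^sub>m gq21_basis 2)"
    then have "u < 9" "v < 9" by simp_all
    then show "(gq21_basis k * gq21_basis l) $$ (u, v) =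
        (x \<cdot>\<^sub>m gq21_basis 0 + y \<cdot>\<^sub>m gq21_basis 1 + z \<cdot>\<^sub>m gq21_basis 2) $$ (u, v)"
      by (simp only: that lin)
  qed simp_all
  show "gq21_basis 1 * gq21_basis 1 = 4 \<cdot>\<^sub>m gq21_basis 0 + 1 \<cdot>\<^sub>m gq21_basis 1 + 2 \<cdot>\<^sub>m gq21_basis 2"
    by (rule eq) (subst ent[OF 1 1]; simp only: gq21_numbers(1) split: if_splits; simp)
  show "gq21_basis 1 * gq21_basis 2 = 0 \<cdot>\<^sub>m gq21_basis 0 + 2 \<cdot>\<^sub>m gq21_basis 1 + 2 \<cdot>\<^sub>m gq21_basis 2"
    by (rule eq) (subst ent[OF 1 2]; simp only: gq21_numbers(2) split: if_splits; simp)
  show "gq21_basis 2 * gq21_basis 1 = 0 \<cdot>\<^sub>m gq21_basis 0 + 2 \<cdot>\<^sub>m gq21_basis 1 + 2 \<cdot>\<^sub>m gq21_basis 2"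
    by (rule eq) (subst ent[OF 2 1]; simp only: gq21_numbers(3) split: if_splits; simp)
  show "gq21_basis 2 * gq21_basis 2 = 4 \<cdot>\<^sub>m gq21_basis 0 + 2 \<cdot>\<^sub>m gq21_basis 1 + 1 \<cdot>\<^sub>m gq21_basis 2"
    by (rule eq) (subst ent[OF 2 2]; simp only: gq21_numbers(4) split: if_splits; simp)
qed

lemma ZGQ21_simps:
  "carrier ZGQ21 = {x \<cdot>\<^sub>m gq21_basis 0 + y \<cdot>\<^sub>m gq21_basis 1 + z \<cdot>\<^sub>m gq21_basis 2 | x y z. True}"
  "A \<otimes>\<^bsub>ZGQ21\<^esub> B = A * B" "A \<oplus>\<^bsub>ZGQ21\<^esub> B = A + B"
  "\<one>\<^bsub>ZGQ21\<^esub> = 1\<^sub>m 9" "\<zero>\<^bsub>ZGQ21\<^esub> = 0\<^sub>m 9 9"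
  by (simp_all add: ZGQ21_def ring_mat_def)

lemma ZGQ21_mult:
  fixes x y z x' y' z' :: int
  shows "(x \<cdot>\<^sub>m gq21_basis 0 + y \<cdot>\<^sub>m gq21_basis 1 + z \<cdot>\<^sub>m gq21_basis 2) *
      (x' \<cdot>\<^sub>m gq21_basis 0 + y' \<cdot>\<^sub>m gq21_basis 1 + z' \<cdot>\<^sub>m gq21_basis 2) =
    (x * x' + 4 * y * y' + 4 * z * z') \<cdot>\<^sub>m gq21_basis 0 +
    (x * y' + y * x' + y * y' + 2 * (y * z' + z * y') + 2 * z * z') \<cdot>\<^sub>m gq21_basis 1 +
    (x * z' + z * x' + 2 * y * y' + 2 * (y * z' + z * y') + z * z') \<cdot>\<^sub>m gq21_basis 2"
    (is "?L = ?R")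
proof -
  let ?B0 = "gq21_basis 0" and ?B1 = "gq21_basis 1" and ?B2 = "gq21_basis 2"
  note c = gq21_basis_carrier
  have c': "x \<cdot>\<^sub>m gq21_basis k \<in> carrier_mat 9 9" for x k by simp
  have s: "(x \<cdot>\<^sub>m gq21_basis k) * (y \<cdot>\<^sub>m gq21_basis l) = (x * y) \<cdot>\<^sub>m (gq21_basis k * gq21_basis l)"
    for x y :: int and k l
    unfolding mult_smult_assoc_mat[OF c c'] mult_smult_distrib[OF c c]
    by (rule eq_matI) simp_all
  have "?L = (x * x') \<cdot>\<^sub>m (?B0 * ?B0) + (y * x') \<cdot>\<^sub>m (?B1 * ?B0) + (z * x') \<cdot>\<^sub>m (?B2 * ?B0)
      + ((x * y') \<cdot>\<^sub>m (?B0 * ?B1) + (y * y') \<cdot>\<^sub>m (?B1 * ?B1) + (z * y') \<cdot>\<^sub>m (?B2 * ?B1))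
      + ((x * z') \<cdot>\<^sub>m (?B0 * ?B2) + (y * z') \<cdot>\<^sub>m (?B1 * ?B2) + (z * z') \<cdot>\<^sub>m (?B2 * ?B2))"
    unfolding s[symmetric]
    by (simp only: add_mult_distrib_mat[of _ 9 9 _ _ 9] mult_add_distrib_mat[of _ 9 9 _ 9]
        c' add_carrier_mat)
  also have "\<dots> = ?R"
    unfolding gq21_basis_mult
    unfolding gq21_basis_0 left_mult_one_mat[OF c] right_mult_one_mat[OF c]
      left_mult_one_mat[OF one_carrier_mat]
    by (rule eq_matI) (simp_all add: algebra_simps del: One_nat_def)
  finally show ?thesis .
qed

lemma ZGQ21_cring: "cring ZGQ21"
proof -
  have carr: "A \<in> carrier_mat 9 9" if "A \<in> carrier ZGQ21" for A
    using that by (auto simp: ZGQ21_simps)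
  have mult: "A * B \<in> carrier ZGQ21" "A * B = B * A" if AB: "A \<in> carrier ZGQ21" "B \<in> carrier ZGQ21" for A B
  proof -
    from AB obtain x y z x' y' z' where A: "A = x \<cdot>\<^sub>m gq21_basis 0 + y \<cdot>\<^sub>m gq21_basis 1 + z \<cdot>\<^sub>m gq21_basis 2"
      and B: "B = x' \<cdot>\<^sub>m gq21_basis 0 + y' \<cdot>\<^sub>m gq21_basis 1 + z' \<cdot>\<^sub>m gq21_basis 2"
      by (auto simp: ZGQ21_simps)
    show "A * B \<in> carrier ZGQ21"
      unfolding A B ZGQ21_mult ZGQ21_simps by blast
    show "A * B = B * A"
      unfolding A B ZGQ21_mult by (simp only: ac_simps)
  qed
  have add: "A + B \<in> carrier ZGQ21" if AB: "A \<in> carrier ZGQ21" "B \<in> carrier ZGQ21" for A B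
  proof -
    from AB obtain x y z x' y' z' where A: "A = x \<cdot>\<^sub>m gq21_basis 0 + y \<cdot>\<^sub>m gq21_basis 1 + z \<cdot>\<^sub>m gq21_basis 2"
      and B: "B = x' \<cdot>\<^sub>m gq21_basis 0 + y' \<cdot>\<^sub>m gq21_basis 1 + z' \<cdot>\<^sub>m gq21_basis 2"
      by (auto simp: ZGQ21_simps)
    have "A + B = (x + x') \<cdot>\<^sub>m gq21_basis 0 + (y + y') \<cdot>\<^sub>m gq21_basis 1 + (z + z') \<cdot>\<^sub>m gq21_basis 2"
      unfolding A B by (rule eq_matI) (simp_all add: algebra_simps del: One_nat_def)
    then show ?thesis unfolding ZGQ21_simps by blast
  qed
  have zero: "0\<^sub>m 9 9 \<in> carrier ZGQ21"
  proof -
    have "0\<^sub>m 9 9 = 0 \<cdot>\<^sub>m gq21_basis 0 + 0 \<cdot>\<^sub>m gq21_basis 1 + 0 \<cdot>\<^sub>m gq21_basis 2"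
      by (rule eq_matI) simp_all
    then show ?thesis unfolding ZGQ21_simps by blast
  qed
  have one: "1\<^sub>m 9 \<in> carrier ZGQ21"
  proof -
    have "1\<^sub>m 9 = 1 \<cdot>\<^sub>m gq21_basis 0 + 0 \<cdot>\<^sub>m gq21_basis 1 + 0 \<cdot>\<^sub>m gq21_basis 2"
      by (rule eq_matI) (simp_all add: gq21_basis_0)
    then show ?thesis unfolding ZGQ21_simps by blast
  qed
  have neg: "\<exists>B\<in>carrier ZGQ21. B + A = 0\<^sub>m 9 9" if "A \<in> carrier ZGQ21" for A
  proof -
    from that obtain x y z where A: "A = x \<cdot>\<^sub>m gq21_basis 0 + y \<cdot>\<^sub>m gq21_basis 1 + z \<cdot>\<^sub>m gq21_basis 2"
      by (auto simp: ZGQ21_simps)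
    have "((- x) \<cdot>\<^sub>m gq21_basis 0 + (- y) \<cdot>\<^sub>m gq21_basis 1 + (- z) \<cdot>\<^sub>m gq21_basis 2) + A = 0\<^sub>m 9 9"
      unfolding A by (rule eq_matI) (simp_all add: algebra_simps del: One_nat_def)
    then show ?thesis unfolding ZGQ21_simps(1) by blast
  qed
  show ?thesis
  proof (rule cringI)
    show "abelian_group ZGQ21"
    proof (rule abelian_groupI, unfold ZGQ21_simps(2-))
      show "A + B + C = A + (B + C)"
        if "A \<in> carrier ZGQ21" "B \<in> carrier ZGQ21" "C \<in> carrier ZGQ21" for A B C
        using that[THEN carr] by (rule assoc_add_mat)
      show "A + B = B + A" if "A \<in> carrier ZGQ21" "B \<in> carrier ZGQ21" for A B
        using that[THEN carr] by (rule comm_add_mat)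
      show "0\<^sub>m 9 9 + A = A" if "A \<in> carrier ZGQ21" for A
        using carr[OF that] by simp
    qed (use add zero neg in auto)
    show "Group.comm_monoid ZGQ21"
    proof (rule comm_monoidI, unfold ZGQ21_simps(2-))
      show "A * B * C = A * (B * C)"
        if "A \<in> carrier ZGQ21" "B \<in> carrier ZGQ21" "C \<in> carrier ZGQ21" for A B C
        using that[THEN carr] by (rule assoc_mult_mat)
      show "1\<^sub>m 9 * A = A" if "A \<in> carrier ZGQ21" for A
        using carr[OF that] by simp
    qed (use mult one in auto)
    show "(A \<oplus>\<^bsub>ZGQ21\<^esub> B) \<otimes>\<^bsub>ZGQ21\<^esub> C = A \<otimes>\<^bsub>ZGQ21\<^esub> C \<oplus>\<^bsub>ZGQ21\<^esub> B \<otimes>\<^bsub>ZGQ21\<^esub> C"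
      if "A \<in> carrier ZGQ21" "B \<in> carrier ZGQ21" "C \<in> carrier ZGQ21" for A B C
      unfolding ZGQ21_simps(2-) using that[THEN carr] by (rule add_mult_distrib_mat)
  qed
qed

end

theory Submission
  imports Defs "HOL-Number_Theory.Cong"
begin

text \<open>Embed the algebra in \<open>\<int>\<^sup>3\<close> by its three characters and choose a triangular basis
  \<open>e\<^sub>1, e\<^sub>2, e\<^sub>3\<close>. A sublattice of finite index has a unique basis \<open>(p,x,y)\<close>, \<open>(0,q,z)\<close>,
  \<open>(0,0,r)\<close> in Hermite normal form, its index is \<open>pqr\<close>, and it is an ideal iff
  \<open>r | q - 3z\<close>, \<open>q | p + 3x\<close> and \<open>r | 2x - 3y - z(p + 3x)/q\<close>. All these congruences are of the form
  \<open>3t \<equiv> c\<close>, so the number of solutions \<open>(x,y,z)\<close> depends only on the divisibility of \<open>p\<close>, \<open>q\<close>, \<open>r\<close>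
  by \<open>3\<close> and \<open>9\<close>. The zeta function is thus a finite combination of products of three series
  \<open>\<Sum>\<^sub>d\<^sub>|\<^sub>n n\<^sup>-\<^sup>s = d\<^sup>-\<^sup>s \<zeta>(s)\<close> with \<open>d \<in> {1,3,9}\<close>; no localisation is needed.\<close>

section \<open>Hermite normal form of lattices in \<open>\<int>\<^sup>3\<close>\<close>

text \<open>Take for \<open>d\<close> the least positive element: the remainder of any element
  modulo \<open>d\<close> stays in \<open>S\<close> and is smaller than \<open>d\<close>, hence is
  zero.\<close>

lemma int_subgroup_eq_multiples:
  fixes S :: "int set"
  assumes diff: "\<And>a b. a \<in> S \<Longrightarrow> b \<in> S \<Longrightarrow> a - b \<in> S"
    and n: "n \<in> S" "n \<noteq> 0"
  obtains d where "d > 0" "\<And>a. a \<in> S \<longleftrightarrow> d dvd a"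
proof -
  have zero: "0 \<in> S" using diff[OF n(1) n(1)] by simp
  have neg: "- a \<in> S" if "a \<in> S" for a using diff[OF zero that] by simp
  have add: "a + b \<in> S" if "a \<in> S" "b \<in> S" for a b using diff[OF that(1) neg[OF that(2)]] by simp
  have mult: "k * a \<in> S" if "a \<in> S" for a k
  proof (induction k rule: int_induct[where k = 0])
    case base
    then show ?case using zero by simp
  next
    case (step1 i)
    then show ?case using add[of "i * a" a] that by (simp add: algebra_simps)
  next
    case (step2 i)
    then show ?case using diff[of "i * a" a] that by (simp add: algebra_simps)
  qed
  define P where "P k \<longleftrightarrow> k > 0 \<and> int k \<in> S" for k
  have "P (nat \<bar>n\<bar>)" using n neg[of n] by (auto simp: P_def abs_if)
  then have PL: "P (Least P)" by (rule LeastI)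
  define d where "d = int (Least P)"
  have d: "d > 0" "d \<in> S" using PL by (auto simp: P_def d_def)
  have "d dvd a" if "a \<in> S" for a
  proof -
    have m: "a mod d \<in> S" using diff[OF that mult[OF d(2), of "a div d"]]
      by (simp add: minus_div_mult_eq_mod)
    have "\<not> P (nat (a mod d))"
      by (rule not_less_Least) (use d in \<open>simp add: d_def nat_less_iff\<close>)
    with m d(1) have "a mod d = 0" by (simp add: P_def) (metis pos_mod_sign less_le)
    then show ?thesis by auto
  qed
  moreover have "a \<in> S" if "d dvd a" for a
    using that mult[OF d(2)] by (auto simp: mult.commute)
  ultimately show ?thesis using that d(1) by blast
qed

text \<open>The row lattice of an upper triangular matrix. The entries above the diagonal form a
  single tuple, so that for a fixed diagonal the lattices are indexed by a set of triples.\<close>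

definition hnf_lattice :: "int \<Rightarrow> int \<Rightarrow> int \<Rightarrow> int \<times> int \<times> int \<Rightarrow> (int \<times> int \<times> int) set" where
  "hnf_lattice p q r = (\<lambda>(x, y, z). {(i * p, i * x + j * q, i * y + j * z + k * r) | i j k. True})"

definition subgroup3 :: "(int \<times> int \<times> int) set \<Rightarrow> bool" where
  "subgroup3 L \<longleftrightarrow> 0 \<in> L \<and> (\<forall>u\<in>L. \<forall>v\<in>L. u - v \<in> L)"

lemma mem_hnf_lattice:
  "(a, b, c) \<in> hnf_lattice p q r (x, y, z) \<longleftrightarrow>
    (\<exists>i j k. a = i * p \<and> b = i * x + j * q \<and> c = i * y + j * z + k * r)"
  by (auto simp: hnf_lattice_def)

lemma subgroup3_hnf_lattice: "subgroup3 (hnf_lattice p q r (x, y, z))"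
proof -
  have "(0, 0, 0) \<in> hnf_lattice p q r (x, y, z)"
    unfolding mem_hnf_lattice by (rule exI[of _ 0])+ simp
  moreover have "(a - a', b - b', c - c') \<in> hnf_lattice p q r (x, y, z)"
    if "(a, b, c) \<in> hnf_lattice p q r (x, y, z)" "(a', b', c') \<in> hnf_lattice p q r (x, y, z)"
    for a b c a' b' c'
  proof -
    from that obtain i j k i' j' k' where
      "a = i * p" "b = i * x + j * q" "c = i * y + j * z + k * r"
      "a' = i' * p" "b' = i' * x + j' * q" "c' = i' * y + j' * z + k' * r"
      unfolding mem_hnf_lattice by blast
    then show ?thesis unfolding mem_hnf_lattice
      by (intro exI[of _ "i - i'"] exI[of _ "j - j'"] exI[of _ "k - k'"]) (simp add: algebra_simps)
  qed
  ultimately show ?thesis by (auto simp: subgroup3_def zero_prod_def)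
qed

lemma subgroup3_add:
  assumes "subgroup3 L" "u \<in> L" "v \<in> L"
  shows "u + v \<in> L"
proof -
  have "u - (0 - v) \<in> L" using assms unfolding subgroup3_def by blast
  then show ?thesis by simp
qed

lemma subgroup3_mult:
  assumes L: "subgroup3 L" and v: "(a, b, c) \<in> L"
  shows "(k * a, k * b, k * c) \<in> L"
proof (induction k rule: int_induct[where k = 0])
  case base
  then show ?case using L by (simp add: subgroup3_def zero_prod_def)
next
  case (step1 i)
  then show ?case using subgroup3_add[OF L _ v, of "(i * a, i * b, i * c)"] by (simp add: algebra_simps)
next
  case (step2 i)
  have "(i * a, i * b, i * c) - (a, b, c) \<in> L" using step2 v L unfolding subgroup3_def by blast
  then show ?case by (simp add: algebra_simps)
qed

lemma subgroup3_diff_mult: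
  assumes L: "subgroup3 L" and "(a', b', c') \<in> L" "(a, b, c) \<in> L"
  shows "(a' - k * a, b' - k * b, c' - k * c) \<in> L"
proof -
  have "(a', b', c') - (k * a, k * b, k * c) \<in> L"
    using subgroup3_mult[OF L assms(3), of k] assms(1,2) unfolding subgroup3_def by blast
  then show ?thesis by simp
qed

lemma hnf_lattice_subset:
  assumes L: "subgroup3 L" and "(p, x, y) \<in> L" "(0, q, z) \<in> L" "(0, 0, r) \<in> L"
  shows "hnf_lattice p q r (x, y, z) \<subseteq> L"
proof
  fix v assume "v \<in> hnf_lattice p q r (x, y, z)"
  then obtain i j k where v: "v = (i * p, i * x + j * q, i * y + j * z + k * r)"
    by (auto simp: hnf_lattice_def)
  show "v \<in> L"
    using subgroup3_add[OF L subgroup3_add[OF L subgroup3_mult[OF L assms(2), of i]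
      subgroup3_mult[OF L assms(3), of j]] subgroup3_mult[OF L assms(4), of k]] by (simp add: v)
qed

lemma hnf_lattice_generators:
  "(p, x, y) \<in> hnf_lattice p q r (x, y, z)"
  "(0, q, z) \<in> hnf_lattice p q r (x, y, z)"
  "(0, 0, r) \<in> hnf_lattice p q r (x, y, z)"
  unfolding mem_hnf_lattice
  by (rule exI[of _ 1] exI[of _ 0])+ (simp,
      (rule exI[of _ 0], rule exI[of _ 1], rule exI[of _ 0], simp),
      (rule exI[of _ 0], rule exI[of _ 0], rule exI[of _ 1], simp))

text \<open>\<open>p\<close> generates the first coordinates of \<open>L\<close>, \<open>q\<close>
  the second coordinates of vectors starting with 0, \<open>r\<close> the third coordinates of
  vectors starting with two zeros. The multiples of the unit vectors ensure that none of these
  groups is trivial.\<close>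

lemma hnf_lattice_exists:
  assumes L: "subgroup3 L" and "n \<noteq> 0" "(n, 0, 0) \<in> L" "(0, n, 0) \<in> L" "(0, 0, n) \<in> L"
  obtains p q r x y z where "p > 0" "q > 0" "r > 0" "0 \<le> x" "x < q" "0 \<le> y" "y < r" "0 \<le> z" "z < r"
    "L = hnf_lattice p q r (x, y, z)"
proof -
  note diff = subgroup3_diff_mult[OF L]
  obtain p where p: "p > 0" "\<And>a. a \<in> {a. \<exists>b c. (a, b, c) \<in> L} \<longleftrightarrow> p dvd a"
  proof (rule int_subgroup_eq_multiples[of "{a. \<exists>b c. (a, b, c) \<in> L}" n])
    show "a - b \<in> {a. \<exists>b c. (a, b, c) \<in> L}"
      if "a \<in> {a. \<exists>b c. (a, b, c) \<in> L}" "b \<in> {a. \<exists>b c. (a, b, c) \<in> L}" for a b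
      using that diff[where k = 1] by fastforce
  qed (use assms in blast)+
  obtain q where q: "q > 0" "\<And>a. a \<in> {b. \<exists>c. (0, b, c) \<in> L} \<longleftrightarrow> q dvd a"
  proof (rule int_subgroup_eq_multiples[of "{b. \<exists>c. (0, b, c) \<in> L}" n])
    show "a - b \<in> {b. \<exists>c. (0, b, c) \<in> L}"
      if "a \<in> {b. \<exists>c. (0, b, c) \<in> L}" "b \<in> {b. \<exists>c. (0, b, c) \<in> L}" for a b
      using that diff[where k = 1 and a = 0 and a' = 0] by fastforce
  qed (use assms in blast)+
  obtain r where r: "r > 0" "\<And>a. a \<in> {c. (0, 0, c) \<in> L} \<longleftrightarrow> r dvd a"
  proof (rule int_subgroup_eq_multiples[of "{c. (0, 0, c) \<in> L}" n])
    show "a - b \<in> {c. (0, 0, c) \<in> L}"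
      if "a \<in> {c. (0, 0, c) \<in> L}" "b \<in> {c. (0, 0, c) \<in> L}" for a b
      using that diff[where k = 1 and a = 0 and a' = 0 and b = 0 and b' = 0] by fastforce
  qed (use assms in blast)+
  have rL: "(0, 0, r) \<in> L" using r(2)[of r] by simp
  obtain z0 where "(0, q, z0) \<in> L" using q(2)[of q] by auto
  from diff[OF this rL, of "z0 div r"] have zL: "(0, q, z0 mod r) \<in> L"
    by (simp add: minus_div_mult_eq_mod)
  define z where "z = z0 mod r"
  obtain x0 y0 where "(p, x0, y0) \<in> L" using p(2)[of p] by auto
  \<comment> \<open>The order matters: reducing the second entry by the row of \<open>q\<close>
    disturbs the third entry, which is therefore reduced last.\<close>
  from diff[OF this zL, of "x0 div q"] obtain y1 where "(p, x0 mod q, y1) \<in> L"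
    by (auto simp add: minus_div_mult_eq_mod)
  from diff[OF this rL, of "y1 div r"] have xL: "(p, x0 mod q, y1 mod r) \<in> L"
    by (simp add: minus_div_mult_eq_mod)
  define x y where "x = x0 mod q" and "y = y1 mod r"
  have "L \<subseteq> hnf_lattice p q r (x, y, z)"
  proof
    fix v assume "v \<in> L"
    then obtain a b c where v: "v = (a, b, c)" "(a, b, c) \<in> L" by (metis prod_cases3)
    then have "p dvd a" using p(2)[of a] by blast
    then obtain i where i: "a = i * p" by (metis dvd_def mult.commute)
    have 1: "(0, b - i * x, c - i * y) \<in> L"
      using diff[OF v(2) xL, of i] by (simp add: i x_def y_def)
    then have "q dvd b - i * x" using q(2)[of "b - i * x"] by blast
    then obtain j where j: "b - i * x = j * q" by (metis dvd_def mult.commute)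
    have "(0, 0, c - i * y - j * z) \<in> L"
      using diff[OF 1 zL, of j] by (simp add: j z_def)
    then have "r dvd c - i * y - j * z" using r(2)[of "c - i * y - j * z"] by blast
    then obtain k where "c - i * y - j * z = k * r" by (metis dvd_def mult.commute)
    with i j show "v \<in> hnf_lattice p q r (x, y, z)" unfolding v(1) mem_hnf_lattice
      by (intro exI[of _ i] exI[of _ j] exI[of _ k]) (simp add: algebra_simps)
  qed
  moreover have "hnf_lattice p q r (x, y, z) \<subseteq> L"
    using hnf_lattice_subset[OF L] xL zL rL by (simp add: x_def y_def z_def)
  ultimately show ?thesis using p(1) q(1) r(1) by (intro that[of p q r x y z]) (auto simp: x_def y_def z_def)
qed

lemma dvd_diff_bounded_imp_eq:
  fixes a b r :: int
  assumes "0 \<le> a" "a < r" "0 \<le> b" "b < r" "r dvd a - b"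
  shows "a = b"
  using assms by (metis mod_eq_dvd_iff mod_pos_pos_trivial)

text \<open>As \<open>p\<close> and \<open>q\<close> are nonzero, a leading zero forces the
  coefficient of the corresponding row to vanish. This is how the lower rows are recovered from the
  lattice.\<close>

lemma hnf_lattice_zero_slices:
  assumes "p > 0" "q > 0"
  shows "(0, 0, c) \<in> hnf_lattice p q r (x, y, z) \<longleftrightarrow> r dvd c"
    and "(0, b, c) \<in> hnf_lattice p q r (x, y, z) \<longleftrightarrow> (\<exists>j. b = j * q \<and> r dvd c - j * z)"
proof -
  show 2: "(0, b, c) \<in> hnf_lattice p q r (x, y, z) \<longleftrightarrow> (\<exists>j. b = j * q \<and> r dvd c - j * z)" for b c
  proof
    show "\<exists>j. b = j * q \<and> r dvd c - j * z" if "(0, b, c) \<in> hnf_lattice p q r (x, y, z)"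
      using that assms unfolding mem_hnf_lattice by fastforce
    assume "\<exists>j. b = j * q \<and> r dvd c - j * z"
    then obtain j where "b = j * q" "r dvd c - j * z" by blast
    moreover from this obtain k where "c - j * z = k * r" by (metis dvd_def mult.commute)
    ultimately have "b = j * q" "c - j * z = k * r" by blast+
    then show "(0, b, c) \<in> hnf_lattice p q r (x, y, z)"
      unfolding mem_hnf_lattice by (intro exI[of _ 0] exI[of _ j] exI[of _ k]) simp
  qed
  show "(0, 0, c) \<in> hnf_lattice p q r (x, y, z) \<longleftrightarrow> r dvd c"
    unfolding 2 using assms by auto
qed

text \<open>The rows are compared from the bottom up: mutual divisibility identifies the diagonal
  entries, and then the entries above them are congruent and reduced, hence equal.\<close>

lemma hnf_lattice_unique:
  assumes eq: "hnf_lattice p q r (x, y, z) = hnf_lattice p' q' r' (x', y', z')"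
    and pos: "p > 0" "q > 0" "r > 0" "p' > 0" "q' > 0" "r' > 0"
    and red: "0 \<le> x" "x < q" "0 \<le> y" "y < r" "0 \<le> z" "z < r"
      "0 \<le> x'" "x' < q'" "0 \<le> y'" "y' < r'" "0 \<le> z'" "z' < r'"
  shows "p = p' \<and> q = q' \<and> r = r' \<and> x = x' \<and> y = y' \<and> z = z'"
proof -
  note g = hnf_lattice_generators[where p = p and q = q and r = r and x = x and y = y and z = z]
  note g' = hnf_lattice_generators[where p = p' and q = q' and r = r' and x = x' and y = y' and z = z']
  note s = hnf_lattice_zero_slices[OF pos(1,2), where r = r and x = x and y = y and z = z]
  note s' = hnf_lattice_zero_slices[OF pos(4,5), where r = r' and x = x' and y = y' and z = z']
  have "r dvd r'" using g'(3) unfolding eq[symmetric] s(1) .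
  moreover have "r' dvd r" using g(3) unfolding eq s'(1) .
  ultimately have r: "r = r'" using pos by (simp add: zdvd_antisym_nonneg)
  have "q dvd q'" using g'(2) unfolding eq[symmetric] s(2) by auto
  moreover obtain j where j: "q = j * q'" "r' dvd z - j * z'" using g(2) unfolding eq s'(2) by auto
  then have "q' dvd q" by simp
  ultimately have q: "q = q'" using pos zdvd_antisym_nonneg[of q q'] by simp
  then have "q' = j * q'" using j(1) by simp
  then have "j = 1" using pos by simp
  with j(2) have "r dvd z - z'" by (simp add: r)
  with red have z: "z = z'" by (intro dvd_diff_bounded_imp_eq) (auto simp: r)
  have "p dvd p'" using g'(1) unfolding eq[symmetric] mem_hnf_lattice by auto
  moreover obtain i j k where ij: "p = i * p'" "x = i * x' + j * q'" "y = i * y' + j * z' + k * r'"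
    using g(1) unfolding eq mem_hnf_lattice by auto
  then have "p' dvd p" by simp
  ultimately have p: "p = p'" using pos zdvd_antisym_nonneg[of p p'] by simp
  then have "p' = i * p'" using ij(1) by simp
  then have i: "i = 1" using pos by simp
  have x: "x = x'" using ij(2) i red by (intro dvd_diff_bounded_imp_eq[of _ q]) (auto simp: q)
  then have "j = 0" using ij(2) i pos by simp
  then have y: "y = y'" using ij(3) i red by (intro dvd_diff_bounded_imp_eq[of _ r]) (auto simp: r)
  show ?thesis using p q r x y z by simp
qed

section \<open>Counting solutions of the congruences\<close>

text \<open>The congruences say that the lattice is an ideal; see \<open>ideal3_hnf_lattice\<close>.\<close>

definition hnf_offdiag :: "int \<Rightarrow> int \<Rightarrow> int \<Rightarrow> (int \<times> int \<times> int) set" where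
  "hnf_offdiag p q r = {(x, y, z). 0 \<le> x \<and> x < q \<and> 0 \<le> y \<and> y < r \<and> 0 \<le> z \<and> z < r \<and>
     r dvd q - 3 * z \<and> q dvd p + 3 * x \<and> r dvd 2 * x - 3 * y - z * ((p + 3 * x) div q)}"

lemma triple_dvd_triple_diff_iff:
  fixes m a b :: int
  shows "3 * m dvd 3 * a - 3 * b \<longleftrightarrow> m dvd a - b"
  by (simp only: right_diff_distrib[symmetric] dvd_mult_cancel_left) simp

text \<open>A class modulo \<open>m\<close> splits into three classes modulo \<open>3 * m\<close>.
  The explicit representatives, and not just their number, are needed in
  \<open>card_hnf_offdiag_dvd\<close>, where a further condition is tested on each.\<close>

lemma bij_betw_triple_residues:
  fixes m c :: int
  assumes "m > 0"
  shows "bij_betw (\<lambda>i. (c + m * i) mod (3 * m)) {0, 1, 2} {t. 0 \<le> t \<and> t < 3 * m \<and> m dvd c - t}"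
proof (rule bij_betw_imageI)
  show "inj_on (\<lambda>i. (c + m * i) mod (3 * m)) {0, 1, 2}"
  proof (rule inj_onI)
    fix i j :: int
    assume ij: "i \<in> {0, 1, 2}" "j \<in> {0, 1, 2}" and "(c + m * i) mod (3 * m) = (c + m * j) mod (3 * m)"
    then have "m * 3 dvd m * (i - j)" by (simp add: mod_eq_dvd_iff algebra_simps)
    then have "3 dvd i - j" using assms by (simp only: dvd_mult_cancel_left) simp
    with ij show "i = j" by auto
  qed
  show "(\<lambda>i. (c + m * i) mod (3 * m)) ` {0, 1, 2} = {t. 0 \<le> t \<and> t < 3 * m \<and> m dvd c - t}" (is "?l = ?r")
  proof (intro equalityI subsetI)
    fix t assume "t \<in> ?l"
    then obtain i where t: "t = (c + m * i) mod (3 * m)" by blast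
    have "t = c + m * i - 3 * m * ((c + m * i) div (3 * m))"
      unfolding t by (simp add: minus_mult_div_eq_mod)
    then have "c - t = m * (3 * ((c + m * i) div (3 * m)) - i)" by (simp add: algebra_simps)
    with assms show "t \<in> ?r" by (auto simp: t)
  next
    fix t assume t: "t \<in> ?r"
    then obtain k where k: "c - t = m * k" by blast
    have "t = t mod (3 * m)" using t by simp
    also have "\<dots> = (c + m * (- k)) mod (3 * m)"
      using k by (intro arg_cong[where f = "\<lambda>a. a mod (3 * m)"]) simp
    also have "\<dots> = (c + m * ((- k) mod 3)) mod (3 * m)"
    proof -
      have "m * (- k) - m * ((- k) mod 3) = 3 * m * ((- k) div 3)"
        unfolding right_diff_distrib[symmetric] minus_mod_eq_mult_div by simp
      then show ?thesis by (simp add: mod_eq_dvd_iff)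
    qed
    finally have "t = (c + m * ((- k) mod 3)) mod (3 * m)" .
    moreover have "(- k) mod 3 \<in> {0, 1, 2}" by auto
    ultimately show "t \<in> ?l" by (rule image_eqI)
  qed
qed

text \<open>If 3 is prime to \<open>m\<close>, it is invertible and the solution is unique.
  Otherwise 3 must divide \<open>c\<close>, and cancelling it leaves one class modulo
  \<open>m div 3\<close>, which has three lifts.\<close>

lemma card_triple_congruence:
  fixes m c :: int
  assumes "m > 0"
  shows "finite {t. 0 \<le> t \<and> t < m \<and> m dvd c - 3 * t}"
    and "card {t. 0 \<le> t \<and> t < m \<and> m dvd c - 3 * t} = (if 3 dvd m then if 3 dvd c then 3 else 0 else 1)"
proof -
  show "finite {t. 0 \<le> t \<and> t < m \<and> m dvd c - 3 * t}"
    by (rule finite_subset[of _ "{0..<m}"]) auto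
  show "card {t. 0 \<le> t \<and> t < m \<and> m dvd c - 3 * t} = (if 3 dvd m then if 3 dvd c then 3 else 0 else 1)"
  proof (cases "3 dvd m")
    case m: True
    show ?thesis
    proof (cases "3 dvd c")
      case True
      with m obtain m' c' where mc: "m = 3 * m'" "c = 3 * c'" by blast
      have "{t. 0 \<le> t \<and> t < m \<and> m dvd c - 3 * t} = {t. 0 \<le> t \<and> t < 3 * m' \<and> m' dvd c' - t}"
        unfolding mc triple_dvd_triple_diff_iff ..
      then show ?thesis
        using bij_betw_same_card[OF bij_betw_triple_residues[of m' c']] assms m True mc by simp
    next
      case False
      have "\<not> m dvd c - 3 * t" for t
      proof
        assume "m dvd c - 3 * t"
        with m have "3 dvd c - 3 * t" by (rule dvd_trans)
        with False show False by presburger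
      qed
      then show ?thesis using False m by simp
    qed
  next
    case False
    then have "coprime 3 m" by (subst prime_imp_coprime_int) simp_all
    then obtain u where u: "m dvd 3 * u - 1" using cong_solve_coprime_int cong_iff_dvd_diff by blast
    have "{t. 0 \<le> t \<and> t < m \<and> m dvd c - 3 * t} = {(u * c) mod m}"
    proof (intro equalityI subsetI)
      fix t assume t: "t \<in> {t. 0 \<le> t \<and> t < m \<and> m dvd c - 3 * t}"
      \<comment> \<open>\<open>u\<close> is an inverse of 3 modulo \<open>m\<close>; the combination
        equals \<open>u * c - t\<close>.\<close>
      have "m dvd u * (c - 3 * t) + t * (3 * u - 1)"
        using t u by (intro dvd_add dvd_mult) auto
      then have "m dvd u * c - t" by (simp add: algebra_simps)
      then have "(u * c) mod m = t mod m" by (simp add: mod_eq_dvd_iff)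
      with t show "t \<in> {(u * c) mod m}" by simp
    next
      fix t assume "t \<in> {(u * c) mod m}"
      then have t: "t = u * c - m * ((u * c) div m)" "0 \<le> t" "t < m"
        using assms by (auto simp: minus_mult_div_eq_mod)
      have "c - 3 * t = 3 * m * ((u * c) div m) - c * (3 * u - 1)" unfolding t(1) by (simp add: algebra_simps)
      also have "m dvd \<dots>" by (rule dvd_diff) (simp, rule dvd_mult[OF u])
      finally show "t \<in> {t. 0 \<le> t \<and> t < m \<and> m dvd c - 3 * t}" using t by simp
    qed
    with False show ?thesis by simp
  qed
qed

text \<open>The congruences for \<open>x\<close> and \<open>z\<close> are independent of each other,
  while the one for \<open>y\<close> involves both. So \<open>y\<close> is counted innermost, by
  \<open>card_triple_congruence\<close>.\<close>

lemma card_hnf_offdiag_sum: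
  assumes "q > 0" "r > 0"
  shows "finite (hnf_offdiag p q r)"
    and "card (hnf_offdiag p q r) =
      (\<Sum>x | 0 \<le> x \<and> x < q \<and> q dvd - p - 3 * x. \<Sum>z | 0 \<le> z \<and> z < r \<and> r dvd q - 3 * z.
        if 3 dvd r then if 3 dvd 2 * x - z * ((p + 3 * x) div q) then 3 else 0 else 1)"
proof -
  let ?X = "{x. 0 \<le> x \<and> x < q \<and> q dvd - p - 3 * x}"
  let ?Z = "{z. 0 \<le> z \<and> z < r \<and> r dvd q - 3 * z}"
  let ?Y = "\<lambda>x z. {y. 0 \<le> y \<and> y < r \<and> r dvd (2 * x - z * ((p + 3 * x) div q)) - 3 * y}"
  let ?S = "SIGMA x:?X. SIGMA z:?Z. ?Y x z"
  have q: "q dvd - p - 3 * x \<longleftrightarrow> q dvd p + 3 * x" for x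
    by (metis dvd_minus_iff minus_add_distrib diff_conv_add_uminus)
  have im: "hnf_offdiag p q r = (\<lambda>(x, z, y). (x, y, z)) ` ?S"
    unfolding hnf_offdiag_def q by (auto simp: image_iff algebra_simps)
  have inj: "inj_on (\<lambda>(x, z, y). (x, y, z)) ?S" by (auto simp: inj_on_def)
  have fin: "finite ?X" "finite ?Z" "\<And>x z. finite (?Y x z)"
    using assms by (intro card_triple_congruence(1); simp)+
  show "finite (hnf_offdiag p q r)" unfolding im using fin by (intro finite_imageI finite_SigmaI)
  have "card ?S = (\<Sum>x\<in>?X. \<Sum>z\<in>?Z. card (?Y x z))"
    by (subst card_SigmaI, use fin in blast, use fin in blast, subst card_SigmaI) (use fin in blast)+
  then show "card (hnf_offdiag p q r) = (\<Sum>x\<in>?X. \<Sum>z\<in>?Z.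
        if 3 dvd r then if 3 dvd 2 * x - z * ((p + 3 * x) div q) then 3 else 0 else 1)"
    unfolding im card_image[OF inj] card_triple_congruence(2)[OF assms(2)] .
qed

text \<open>With \<open>x = - p + q * j\<close> and \<open>z = q + r * i\<close>, up to multiples of
  \<open>3 * q\<close> and \<open>3 * r\<close>, the quotient is \<open>j\<close> modulo 3 and
  \<open>y\<close> exists iff 3 divides \<open>p + j * (q - r * i)\<close>. Each of the nine pairs
  \<open>(i, j)\<close> that passes this test contributes three values of \<open>y\<close>.\<close>

lemma card_hnf_offdiag_dvd:
  assumes "q > 0" "r > 0"
  shows "card (hnf_offdiag (3 * p) (3 * q) (3 * r)) =
    (if 3 dvd r then if 3 dvd q then if 3 dvd p then 27 else 0 else 9 else if 3 dvd p then 15 else 6)"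
proof -
  let ?x = "\<lambda>j. (- p + q * j) mod (3 * q)" and ?z = "\<lambda>i. (q + r * i) mod (3 * r)"
  have X: "{x. 0 \<le> x \<and> x < 3 * q \<and> 3 * q dvd - (3 * p) - 3 * x} = {x. 0 \<le> x \<and> x < 3 * q \<and> q dvd - p - x}"
    using triple_dvd_triple_diff_iff[of q "- p"] by simp
  have Z: "{z. 0 \<le> z \<and> z < 3 * r \<and> 3 * r dvd 3 * q - 3 * z} = {z. 0 \<le> z \<and> z < 3 * r \<and> r dvd q - z}"
    unfolding triple_dvd_triple_diff_iff ..
  have key: "3 dvd 2 * ?x j - ?z i * ((3 * p + 3 * ?x j) div (3 * q)) \<longleftrightarrow>
      3 dvd p mod 3 + j * (q mod 3 - (r mod 3) * i)" for i j
  proof -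
    obtain e where e: "?x j = - p + q * j - 3 * q * e" by (metis minus_mult_div_eq_mod)
    obtain e' where e': "?z i = q + r * i - 3 * r * e'" by (metis minus_mult_div_eq_mod)
    have "(3 * p + 3 * ?x j) = 3 * q * (j - 3 * e)" unfolding e by (simp add: algebra_simps)
    then have k: "(3 * p + 3 * ?x j) div (3 * q) = j - 3 * e" using assms by simp
    \<comment> \<open>The term \<open>- 2 * p\<close> from \<open>2 * ?x j\<close> counts as
      \<open>p\<close> modulo 3.\<close>
    have "2 * ?x j - ?z i * (j - 3 * e) - (p + j * (q - r * i)) =
        3 * (- p - 2 * q * e + r * e' * j + (q + r * i) * e - 3 * r * e' * e)"
      unfolding e e' by (simp add: algebra_simps)
    then have "3 dvd 2 * ?x j - ?z i * (j - 3 * e) - (p + j * (q - r * i))" by (rule dvdI)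
    then have "3 dvd 2 * ?x j - ?z i * (j - 3 * e) \<longleftrightarrow> 3 dvd p + j * (q - r * i)"
      by (metis dvd_diff_left_iff dvd_diff_right_iff)
    also have "\<dots> \<longleftrightarrow> 3 dvd p mod 3 + j * (q mod 3 - (r mod 3) * i)"
    proof -
      obtain a b c where abc: "p mod 3 = p - 3 * a" "q mod 3 = q - 3 * b" "r mod 3 = r - 3 * c"
        by (metis minus_mult_div_eq_mod)
      have "p + j * (q - r * i) - (p mod 3 + j * (q mod 3 - (r mod 3) * i)) = 3 * (a + j * (b - c * i))"
        unfolding abc by (simp add: algebra_simps)
      then have "3 dvd p + j * (q - r * i) - (p mod 3 + j * (q mod 3 - (r mod 3) * i))" by (rule dvdI)
      then show ?thesis by (metis dvd_diff_left_iff dvd_diff_right_iff)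
    qed
    finally show ?thesis unfolding k .
  qed
  have "3 * q > 0" "3 * r > 0" using assms by simp_all
  from card_hnf_offdiag_sum(2)[OF this, of "3 * p", unfolded X Z]
  have "card (hnf_offdiag (3 * p) (3 * q) (3 * r)) =
      (\<Sum>x | 0 \<le> x \<and> x < 3 * q \<and> q dvd - p - x. \<Sum>z | 0 \<le> z \<and> z < 3 * r \<and> r dvd q - z.
        if 3 dvd 2 * x - z * ((3 * p + 3 * x) div (3 * q)) then 3 else 0)"
    by (simp only: dvd_triv_left if_True)
  also have "\<dots> = (\<Sum>j\<in>{0,1,2}. \<Sum>z | 0 \<le> z \<and> z < 3 * r \<and> r dvd q - z.
        if 3 dvd 2 * ?x j - z * ((3 * p + 3 * ?x j) div (3 * q)) then 3 else 0)"
    by (rule sum.reindex_bij_betw[OF bij_betw_triple_residues[OF assms(1)], symmetric])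
  also have "\<dots> = (\<Sum>j\<in>{0,1,2}. \<Sum>i\<in>{0,1,2}.
      if 3 dvd 2 * ?x j - ?z i * ((3 * p + 3 * ?x j) div (3 * q)) then 3 else 0)"
    by (intro sum.cong refl sum.reindex_bij_betw[OF bij_betw_triple_residues[OF assms(2)], symmetric])
  also have "\<dots> = (\<Sum>j\<in>{0,1,2}. \<Sum>i\<in>{0,1,2}. if 3 dvd p mod 3 + j * (q mod 3 - (r mod 3) * i) then 3 else 0)"
    unfolding key ..
  also have "\<dots> = (if 3 dvd r then if 3 dvd q then if 3 dvd p then 27 else 0 else 9 else if 3 dvd p then 15 else 6)"
  \<comment> \<open>Only residues modulo 3 occur now, so the sum is evaluated in each of the 27
    cases.\<close>
  proof -
    have "p mod 3 = 0 \<or> p mod 3 = 1 \<or> p mod 3 = 2" "q mod 3 = 0 \<or> q mod 3 = 1 \<or> q mod 3 = 2"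
      "r mod 3 = 0 \<or> r mod 3 = 1 \<or> r mod 3 = 2" by presburger+
    then show ?thesis unfolding dvd_eq_mod_eq_0[of 3 p] dvd_eq_mod_eq_0[of 3 q] dvd_eq_mod_eq_0[of 3 r]
      by (elim disjE) simp_all
  qed
  finally show ?thesis .
qed

text \<open>If 3 divides \<open>r\<close>, then \<open>z\<close> exists only if 3 divides
  \<open>q\<close>, and then \<open>x\<close> only if 3 divides \<open>p\<close>; so either all
  three are multiples of 3 or there is no solution. If 3 does not divide \<open>r\<close>, then
  \<open>y\<close> and \<open>z\<close> are unique and only the choices of \<open>x\<close> are
  counted.\<close>

lemma card_hnf_offdiag:
  assumes "q > 0" "r > 0"
  shows "card (hnf_offdiag p q r) =
    (if 3 dvd r then
       if 3 dvd q \<and> 3 dvd p then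
         if 9 dvd r then if 9 dvd q then if 9 dvd p then 27 else 0 else 9 else if 9 dvd p then 15 else 6
       else 0
     else if 3 dvd q then if 3 dvd p then 3 else 0 else 1)"
proof (cases "3 dvd r")
  case r: True
  have 9: "9 dvd 3 * a \<longleftrightarrow> 3 dvd a" for a :: int by presburger
  show ?thesis
  proof (cases "3 dvd q \<and> 3 dvd p")
    case True
    with r obtain p' q' r' where "p = 3 * p'" "q = 3 * q'" "r = 3 * r'" by (elim conjE dvdE)
    then show ?thesis using assms card_hnf_offdiag_dvd[of q' r' p'] by (simp add: 9)
  next
    case False
    then have "card {x. 0 \<le> x \<and> x < q \<and> q dvd - p - 3 * x} = 0 \<or> card {z. 0 \<le> z \<and> z < r \<and> r dvd q - 3 * z} = 0"
      using r assms by (auto simp: card_triple_congruence(2))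
    then have "{x. 0 \<le> x \<and> x < q \<and> q dvd - p - 3 * x} = {} \<or> {z. 0 \<le> z \<and> z < r \<and> r dvd q - 3 * z} = {}"
      using card_triple_congruence(1)[OF assms(1), of "- p"] card_triple_congruence(1)[OF assms(2), of q] by simp
    then have "card (hnf_offdiag p q r) = 0"
      unfolding card_hnf_offdiag_sum(2)[OF assms] by (elim disjE) (simp_all only: sum.empty sum.neutral_const)
    then show ?thesis using False r by simp
  qed
next
  case False
  then show ?thesis
    unfolding card_hnf_offdiag_sum(2)[OF assms] using assms
    by (simp add: card_triple_congruence(2))
qed

section \<open>Ideals of the adjacency algebra\<close>

text \<open>Under the three characters of the scheme, \<open>b\<^sub>0\<close>, \<open>b\<^sub>1\<close>, \<open>b\<^sub>2\<close> become \<open>(1,1,1)\<close>, \<open>(4,1,-2)\<close>, \<open>(4,-2,1)\<close>.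
  The coordinates used here refer to the basis \<open>e\<^sub>1 = (1,1,1)\<close>, \<open>e\<^sub>2 = b\<^sub>1 - b\<^sub>2 = (0,3,-3)\<close>,
  \<open>e\<^sub>3 = 4b\<^sub>0 - 2b\<^sub>1 + b\<^sub>2 = (0,0,9)\<close>, in which multiplication is triangular.\<close>

definition elt :: "int \<times> int \<times> int \<Rightarrow> int mat" where
  "elt = (\<lambda>(a, b, c). (a + 4 * c) \<cdot>\<^sub>m gq21_basis 0 + (b - 2 * c) \<cdot>\<^sub>m gq21_basis 1 + (c - b) \<cdot>\<^sub>m gq21_basis 2)"

lemma elt_add: "elt (u + v) = elt u + elt v"
  by (cases u; cases v) (auto simp: elt_def algebra_simps intro!: eq_matI simp del: One_nat_def)

lemma elt_zero: "elt 0 = 0\<^sub>m 9 9"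
  by (auto simp: elt_def zero_prod_def intro!: eq_matI)

lemma range_elt: "range elt = carrier ZGQ21"
proof (intro equalityI subsetI)
  fix A assume "A \<in> carrier ZGQ21"
  then obtain x y z where A: "A = x \<cdot>\<^sub>m gq21_basis 0 + y \<cdot>\<^sub>m gq21_basis 1 + z \<cdot>\<^sub>m gq21_basis 2"
    by (auto simp: ZGQ21_simps)
  \<comment> \<open>The solution of \<open>a + 4 * c = x\<close>, \<open>b - 2 * c = y\<close>,
    \<open>c - b = z\<close>; it is integral because the change of basis is unimodular.\<close>
  have "A = elt (x + 4 * y + 4 * z, - y - 2 * z, - y - z)"
    by (simp add: A elt_def)
  then show "A \<in> range elt" by blast
qed (auto simp: elt_def ZGQ21_simps)

lemma inj_elt: "inj elt"
proof (rule injI)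
  fix u v assume eq: "elt u = elt v"
  obtain a b c a' b' c' where uv: "u = (a, b, c)" "v = (a', b', c')" by (metis prod_cases3)
  \<comment> \<open>Vertices 0, 1 and 4 lie at distances 0, 1 and 2 from vertex 0, so these entries
    of the first row are the three coefficients.\<close>
  have ent: "elt (a, b, c) $$ (0, 0) = a + 4 * c" "elt (a, b, c) $$ (0, 1) = b - 2 * c"
    "elt (a, b, c) $$ (0, 4) = c - b" for a b c
  proof -
    have "\<not> at_distance gq21_edges 1 0 0" "\<not> at_distance gq21_edges 2 0 0" "at_distance gq21_edges 1 0 1"
      "\<not> at_distance gq21_edges 2 0 1" "\<not> at_distance gq21_edges 1 0 4" "at_distance gq21_edges 2 0 4"
      unfolding gq21_distance_1 gq21_distance_2 by (simp_all add: gq21_edges_def)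
    then show "elt (a, b, c) $$ (0, 0) = a + 4 * c" "elt (a, b, c) $$ (0, 1) = b - 2 * c"
      "elt (a, b, c) $$ (0, 4) = c - b"
      by (simp_all add: elt_def gq21_basis_entry at_distance_0 del: One_nat_def)
  qed
  from eq show "u = v" unfolding uv using ent[of a b c] ent[of a' b' c'] by simp
qed

text \<open>Here \<open>e\<^sub>1\<close> is the identity,
  \<open>e\<^sub>2 * e\<^sub>2 = 3 e\<^sub>2 + 2 e\<^sub>3\<close>,
  \<open>e\<^sub>2 * e\<^sub>3 = - 3 e\<^sub>3\<close> and
  \<open>e\<^sub>3 * e\<^sub>3 = 9 e\<^sub>3\<close>.\<close>

lemma elt_mult:
  "elt (a, b, c) * elt (a', b', c') =
    elt (a * a', a * b' + b * a' + 3 * b * b', a * c' + c * a' + 2 * b * b' - 3 * (b * c' + c * b') + 9 * c * c')"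
proof -
  have cong: "x \<cdot>\<^sub>m gq21_basis 0 + y \<cdot>\<^sub>m gq21_basis 1 + z \<cdot>\<^sub>m gq21_basis 2 =
      x' \<cdot>\<^sub>m gq21_basis 0 + y' \<cdot>\<^sub>m gq21_basis 1 + z' \<cdot>\<^sub>m gq21_basis 2"
    if "x = x'" "y = y'" "z = z'" for x y z x' y' z' :: int
    unfolding that ..
  show ?thesis unfolding elt_def prod.case ZGQ21_mult
    by (rule cong) (simp_all add: algebra_simps)
qed

lemma elt_minus: "\<ominus>\<^bsub>ZGQ21\<^esub> elt u = elt (- u)"
proof -
  interpret cring ZGQ21 by (rule ZGQ21_cring)
  have "elt (- u) \<oplus>\<^bsub>ZGQ21\<^esub> elt u = \<zero>\<^bsub>ZGQ21\<^esub>"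
    by (simp add: ZGQ21_simps(2-) elt_zero flip: elt_add)
  then show ?thesis by (intro minus_equality) (auto simp flip: range_elt)
qed

lemma elt_diff: "elt u \<ominus>\<^bsub>ZGQ21\<^esub> elt v = elt (u - v)"
  by (simp add: a_minus_def elt_minus ZGQ21_simps(2-) flip: elt_add)

text \<open>The two closure conditions are multiplication by \<open>e\<^sub>2\<close> and by \<open>e\<^sub>3\<close>.\<close>

definition ideal3 :: "(int \<times> int \<times> int) set \<Rightarrow> bool" where
  "ideal3 L \<longleftrightarrow> subgroup3 L \<and>
    (\<forall>a b c. (a, b, c) \<in> L \<longrightarrow> (0, a + 3 * b, 2 * b - 3 * c) \<in> L \<and> (0, 0, a - 3 * b + 9 * c) \<in> L)"

lemma ideal_elt_image:
  assumes "ideal3 L"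
  shows "ideal (elt ` L) ZGQ21"
proof -
  interpret cring ZGQ21 by (rule ZGQ21_cring)
  have L: "subgroup3 L" using assms by (simp add: ideal3_def)
  have mult: "elt w \<otimes>\<^bsub>ZGQ21\<^esub> elt v \<in> elt ` L" if v: "v \<in> L" for v w
  proof -
    obtain a b c a' b' c' where vw: "v = (a, b, c)" "w = (a', b', c')" by (metis prod_cases3)
    have "(0, a + 3 * b, 2 * b - 3 * c) \<in> L" "(0, 0, a - 3 * b + 9 * c) \<in> L"
      using assms v unfolding vw ideal3_def by auto
    \<comment> \<open>The product is expanded along \<open>w\<close>: integer multiples of
      \<open>v\<close> and of its products with \<open>e\<^sub>2\<close> and
      \<open>e\<^sub>3\<close>.\<close>
    with v have "(a' * a, a' * b, a' * c) + (b' * 0, b' * (a + 3 * b), b' * (2 * b - 3 * c)) +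
        (c' * 0, c' * 0, c' * (a - 3 * b + 9 * c)) \<in> L" unfolding vw
      by (intro subgroup3_add[OF L] subgroup3_mult[OF L])
    moreover have "elt w \<otimes>\<^bsub>ZGQ21\<^esub> elt v = elt ((a' * a, a' * b, a' * c) +
        (b' * 0, b' * (a + 3 * b), b' * (2 * b - 3 * c)) + (c' * 0, c' * 0, c' * (a - 3 * b + 9 * c)))"
      unfolding vw ZGQ21_simps(2) elt_mult
      by (intro arg_cong[where f = elt]) (simp add: algebra_simps)
    ultimately show ?thesis by blast
  qed
  show ?thesis
  proof (rule idealI[OF ring_axioms])
    show "subgroup (elt ` L) (add_monoid ZGQ21)"
    proof (rule group.subgroupI[OF a_group])
      show "elt ` L \<noteq> {}" using L by (auto simp: subgroup3_def)
      show "elt ` L \<subseteq> carrier (add_monoid ZGQ21)" by (auto simp flip: range_elt)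
      show "inv\<^bsub>add_monoid ZGQ21\<^esub> A \<in> elt ` L" if "A \<in> elt ` L" for A
      proof -
        from that obtain u where u: "A = elt u" "u \<in> L" by blast
        have "0 - u \<in> L" using L u unfolding subgroup3_def by blast
        then show ?thesis using u elt_minus[of u] by (simp add: a_inv_def)
      qed
      show "A \<otimes>\<^bsub>add_monoid ZGQ21\<^esub> B \<in> elt ` L" if "A \<in> elt ` L" "B \<in> elt ` L" for A B
        using that subgroup3_add[OF L] by (auto simp: ZGQ21_simps(3) simp flip: elt_add)
    qed
  next
    fix A B assume AB: "A \<in> elt ` L" "B \<in> carrier ZGQ21"
    then show "B \<otimes>\<^bsub>ZGQ21\<^esub> A \<in> elt ` L" using mult by (auto simp flip: range_elt)
    moreover have "A \<otimes>\<^bsub>ZGQ21\<^esub> B = B \<otimes>\<^bsub>ZGQ21\<^esub> A"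
      using AB range_elt by (intro m_comm) auto
    ultimately show "A \<otimes>\<^bsub>ZGQ21\<^esub> B \<in> elt ` L" by simp
  qed
qed

lemma ideal3_vimage:
  assumes "ideal I ZGQ21"
  shows "ideal3 (elt -` I)"
proof -
  interpret ideal I ZGQ21 by fact
  have carr: "elt u \<in> carrier ZGQ21" for u by (simp flip: range_elt)
  have "elt (u - v) \<in> I" if "elt u \<in> I" "elt v \<in> I" for u v
    using that unfolding elt_diff[symmetric] by (simp add: a_minus_def)
  moreover have "elt 0 \<in> I" using additive_subgroup.zero_closed[OF is_additive_subgroup]
    by (simp add: elt_zero ZGQ21_simps(2-))
  moreover have "elt (0, a + 3 * b, 2 * b - 3 * c) \<in> I" if "elt (a, b, c) \<in> I" for a b c
    using I_l_closed[OF that carr[of "(0, 1, 0)"]] by (simp add: ZGQ21_simps(2) elt_mult)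
  moreover have "elt (0, 0, a - 3 * b + 9 * c) \<in> I" if "elt (a, b, c) \<in> I" for a b c
    using I_l_closed[OF that carr[of "(0, 0, 1)"]] by (simp add: ZGQ21_simps(2) elt_mult)
  ultimately show ?thesis by (auto simp: ideal3_def subgroup3_def)
qed

lemma ideal_eq_elt_image:
  assumes "ideal I ZGQ21"
  shows "I = elt ` (elt -` I)"
  using ideal.Icarr[OF assms] by (auto simp flip: range_elt)

text \<open>Closure is tested on the rows. The row of \<open>q\<close> yields the first congruence,
  the product of the row of \<open>p\<close> with \<open>e\<^sub>2\<close> the other two. The
  product of the row of \<open>p\<close> with \<open>e\<^sub>3\<close> adds nothing, since
  \<open>p - 3 * x + 9 * y\<close> is a combination of the quantities already divisible by
  \<open>r\<close>.\<close>

lemma ideal3_hnf_lattice: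
  assumes "p > 0" "q > 0"
  shows "ideal3 (hnf_lattice p q r (x, y, z)) \<longleftrightarrow>
    r dvd q - 3 * z \<and> q dvd p + 3 * x \<and> r dvd 2 * x - 3 * y - z * ((p + 3 * x) div q)"
    (is "ideal3 ?L \<longleftrightarrow> ?R")
proof
  note s = hnf_lattice_zero_slices[OF assms, where r = r and x = x and y = y and z = z]
  note g = hnf_lattice_generators[where p = p and q = q and r = r and x = x and y = y and z = z]
  assume L: "ideal3 ?L"
  then have "(0, 3 * q, 2 * q - 3 * z) \<in> ?L" "(0, 0, 9 * z - 3 * q) \<in> ?L"
    using g(2) unfolding ideal3_def by fastforce+
  then have "r dvd 2 * q - 3 * z - 3 * z" "r dvd 9 * z - 3 * q" unfolding s using assms by auto
  \<comment> \<open>The two terms are 2 and -3 times \<open>q - 3 * z\<close>, so their sum is its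
    negative.\<close>
  then have "r dvd (2 * q - 3 * z - 3 * z) + (9 * z - 3 * q)" by (rule dvd_add)
  then have 1: "r dvd q - 3 * z" by (simp add: dvd_diff_commute)
  have "(0, p + 3 * x, 2 * x - 3 * y) \<in> ?L" using L g(1) unfolding ideal3_def by blast
  then obtain j where "p + 3 * x = j * q" "r dvd 2 * x - 3 * y - j * z" unfolding s by blast
  with 1 assms show ?R by (simp add: mult.commute)
next
  note s = hnf_lattice_zero_slices[OF assms, where r = r and x = x and y = y and z = z]
  assume R: ?R
  then obtain m where m: "p + 3 * x = m * q" by (metis dvd_def mult.commute)
  with R assms have r: "r dvd q - 3 * z" "r dvd 2 * x - 3 * y - m * z" by (simp_all add: mult.commute)
  have "(0, a + 3 * b, 2 * b - 3 * c) \<in> ?L \<and> (0, 0, a - 3 * b + 9 * c) \<in> ?L" if "(a, b, c) \<in> ?L" for a b c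
  proof -
    from that obtain i j k where v: "a = i * p" "b = i * x + j * q" "c = i * y + j * z + k * r"
      unfolding mem_hnf_lattice by blast
    have p: "p = m * q - 3 * x" using m by simp
    have "2 * b - 3 * c - (i * m + 3 * j) * z = i * (2 * x - 3 * y - m * z) + 2 * j * (q - 3 * z) - 3 * k * r"
      unfolding v by (simp add: algebra_simps)
    also have "r dvd \<dots>" using r by (intro dvd_diff dvd_add) (simp_all add: dvd_mult)
    finally have "r dvd 2 * b - 3 * c - (i * m + 3 * j) * z" .
    moreover have "a + 3 * b = (i * m + 3 * j) * q" unfolding v p by (simp add: algebra_simps)
    moreover have "r dvd a - 3 * b + 9 * c"
    proof -
      have "a - 3 * b + 9 * c = (- 3 * i) * (2 * x - 3 * y - m * z) + (i * m - 3 * j) * (q - 3 * z) + 9 * k * r"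
        unfolding v p by (simp add: algebra_simps)
      also have "r dvd \<dots>" using r by (intro dvd_add) (simp_all add: dvd_mult)
      finally show ?thesis .
    qed
    ultimately show ?thesis using s(1)[of "a - 3 * b + 9 * c"] s(2)[of "a + 3 * b" "2 * b - 3 * c"] by blast
  qed
  then show "ideal3 ?L" unfolding ideal3_def using subgroup3_hnf_lattice by blast
qed

section \<open>Index of an ideal and the number of ideals of given index\<close>

lemma coset_eq_iff:
  assumes "ideal3 L"
  shows "elt ` L +>\<^bsub>ZGQ21\<^esub> elt u = elt ` L +>\<^bsub>ZGQ21\<^esub> elt v \<longleftrightarrow> u - v \<in> L"
proof -
  interpret cring ZGQ21 by (rule ZGQ21_cring)
  have "elt ` L +>\<^bsub>ZGQ21\<^esub> elt u = elt ` L +>\<^bsub>ZGQ21\<^esub> elt v \<longleftrightarrow> elt u \<ominus>\<^bsub>ZGQ21\<^esub> elt v \<in> elt ` L"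
    using range_elt by (intro quotient_eq_iff_same_a_r_cos[symmetric] ideal_elt_image assms) auto
  then show ?thesis unfolding elt_diff using inj_elt by (auto simp: inj_image_mem_iff)
qed

lemma carrier_Quot: "carrier (ZGQ21 Quot I) = range (\<lambda>u. I +>\<^bsub>ZGQ21\<^esub> elt u)"
  by (auto simp: FactRing_def A_RCOSETS_def' simp flip: range_elt)

text \<open>Division with remainder, row by row, gives each coset exactly one representative in the
  box with sides \<open>p\<close>, \<open>q\<close>, \<open>r\<close>.\<close>

lemma order_Quot_hnf_lattice:
  assumes L: "ideal3 (hnf_lattice p q r (x, y, z))" and pos: "p > 0" "q > 0" "r > 0"
  shows "order (ZGQ21 Quot (elt ` hnf_lattice p q r (x, y, z))) = nat p * nat q * nat r"
proof -
  let ?L = "hnf_lattice p q r (x, y, z)"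
  let ?f = "\<lambda>u. elt ` ?L +>\<^bsub>ZGQ21\<^esub> elt u"
  let ?B = "{0..<p} \<times> {0..<q} \<times> {0..<r}"
  have "bij_betw ?f ?B (carrier (ZGQ21 Quot (elt ` ?L)))"
  proof (rule bij_betw_imageI)
    show "inj_on ?f ?B"
    proof (rule inj_onI)
      fix u v assume uv: "u \<in> ?B" "v \<in> ?B" and "?f u = ?f v"
      then have "u - v \<in> ?L" by (simp add: coset_eq_iff[OF L])
      moreover obtain a b c a' b' c' where e: "u = (a, b, c)" "v = (a', b', c')" by (metis prod_cases3)
      ultimately obtain i j k where ijk: "a - a' = i * p" "b - b' = i * x + j * q" "c - c' = i * y + j * z + k * r"
        by (auto simp: mem_hnf_lattice)
      have a: "a = a'" using uv ijk by (intro dvd_diff_bounded_imp_eq[of _ p]) (auto simp: e)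
      with ijk pos have i: "i = 0" by simp
      have b: "b = b'" using uv ijk i by (intro dvd_diff_bounded_imp_eq[of _ q]) (auto simp: e)
      with ijk pos i have j: "j = 0" by simp
      have c: "c = c'" using uv ijk i j by (intro dvd_diff_bounded_imp_eq[of _ r]) (auto simp: e)
      show "u = v" using a b c e by simp
    qed
    show "?f ` ?B = carrier (ZGQ21 Quot (elt ` ?L))"
      unfolding carrier_Quot
    proof (intro equalityI subsetI)
      fix X assume "X \<in> range ?f"
      then obtain a b c where X: "X = ?f (a, b, c)" by auto
      \<comment> \<open>\<open>b1\<close> and \<open>c1\<close> are what is left of the second and
        third coordinates once the multiples of the rows above have been subtracted.\<close>
      define b1 where "b1 = b - (a div p) * x"
      define c1 where "c1 = c - (a div p) * y - (b1 div q) * z"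
      have "(a, b, c) - (a mod p, b1 mod q, c1 mod r) \<in> ?L"
        unfolding diff_Pair mem_hnf_lattice
        by (intro exI[of _ "a div p"] exI[of _ "b1 div q"] exI[of _ "c1 div r"])
          (simp add: minus_mod_eq_div_mult, simp add: b1_def c1_def algebra_simps minus_mod_eq_div_mult[symmetric])
      then have "X = ?f (a mod p, b1 mod q, c1 mod r)" unfolding X coset_eq_iff[OF L] .
      moreover have "(a mod p, b1 mod q, c1 mod r) \<in> ?B" using pos by simp
      ultimately show "X \<in> ?f ` ?B" by blast
    qed blast
  qed
  from bij_betw_same_card[OF this] show ?thesis by (simp add: order_def card_cartesian_product)
qed

text \<open>Pigeonhole: two distinct multiples of the vector share a coset, and \<open>n\<close> is
  the difference of the factors. This supplies the hypotheses of
  \<open>hnf_lattice_exists\<close>.\<close>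

lemma finite_index_multiple:
  assumes L: "ideal3 L" and fin: "finite (carrier (ZGQ21 Quot (elt ` L)))"
  shows "\<exists>n. n \<noteq> 0 \<and> (n * a, n * b, n * c) \<in> L"
proof -
  let ?f = "\<lambda>k::int. elt ` L +>\<^bsub>ZGQ21\<^esub> elt (k * a, k * b, k * c)"
  have "finite (range ?f)"
    by (rule finite_subset[OF _ fin]) (auto simp: carrier_Quot)
  then have "\<not> inj ?f" using finite_imageD infinite_UNIV_int by blast
  then obtain k l where "k \<noteq> l" "?f k = ?f l" by (auto simp: inj_def)
  then show ?thesis unfolding coset_eq_iff[OF L]
    by (intro exI[of _ "k - l"]) (simp add: algebra_simps)
qed

lemma finite_factor_triples:
  assumes "n > 0"
  shows "finite {(p, q, r). p * q * r = (n :: nat)}"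
proof (rule finite_subset)
  show "{(p, q, r). p * q * r = n} \<subseteq> {..n} \<times> {..n} \<times> {..n}"
  proof
    fix t assume "t \<in> {(p, q, r). p * q * r = n}"
    then obtain p q r where t: "t = (p, q, r)" "p * q * r = n" by auto
    then have "p dvd n" "q dvd n" "r dvd n" by auto
    then show "t \<in> {..n} \<times> {..n} \<times> {..n}" using assms t(1) by (simp add: dvd_imp_le)
  qed
qed simp

text \<open>Ideals of index \<open>n\<close> correspond bijectively to Hermite normal forms whose
  diagonal has product \<open>n\<close> and whose remaining entries satisfy the congruences.\<close>

lemma ideal_count_ZGQ21:
  assumes "n > 0"
  shows "ideal_count ZGQ21 n =
    (\<Sum>(p, q, r) | p * q * r = n. card (hnf_offdiag (int p) (int q) (int r)))"
proof -
  let ?T = "{(p, q, r). p * q * r = n}"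
  let ?f = "\<lambda>((p, q, r), v). elt ` hnf_lattice (int p) (int q) (int r) v"
  let ?S = "SIGMA (p, q, r) : ?T. hnf_offdiag (int p) (int q) (int r)"
  have T: "p > 0" "q > 0" "r > 0" if "(p, q, r) \<in> ?T" for p q r
    using that assms by (auto intro!: Nat.gr0I)
  have "bij_betw ?f ?S {I. ideal I ZGQ21 \<and> order (ZGQ21 Quot I) = n}"
  proof (rule bij_betw_imageI)
    show "inj_on ?f ?S"
    proof (rule inj_onI)
      fix t t' assume "t \<in> ?S" "t' \<in> ?S" "?f t = ?f t'"
      moreover obtain p q r x y z where t: "t = ((p, q, r), x, y, z)" by (metis prod_cases3)
      moreover obtain p' q' r' x' y' z' where t': "t' = ((p', q', r'), x', y', z')" by (metis prod_cases3)
      ultimately have S: "(p, q, r) \<in> ?T" "(x, y, z) \<in> hnf_offdiag (int p) (int q) (int r)"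
        "(p', q', r') \<in> ?T" "(x', y', z') \<in> hnf_offdiag (int p') (int q') (int r')"
        and "elt ` hnf_lattice (int p) (int q) (int r) (x, y, z) =
          elt ` hnf_lattice (int p') (int q') (int r') (x', y', z')" by auto
      then have eq: "hnf_lattice (int p) (int q) (int r) (x, y, z) = hnf_lattice (int p') (int q') (int r') (x', y', z')"
        using inj_elt by (simp add: inj_image_eq_iff)
      have "int p > 0" "int q > 0" "int r > 0" "int p' > 0" "int q' > 0" "int r' > 0"
        using T[OF S(1)] T[OF S(3)] by simp_all
      from hnf_lattice_unique[OF eq this] S(2,4) show "t = t'"
        by (simp add: hnf_offdiag_def t t')
    qed
    show "?f ` ?S = {I. ideal I ZGQ21 \<and> order (ZGQ21 Quot I) = n}"
    proof (intro equalityI subsetI)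
      fix I assume "I \<in> ?f ` ?S"
      then obtain p q r x y z where I: "I = elt ` hnf_lattice (int p) (int q) (int r) (x, y, z)"
        and S: "(p, q, r) \<in> ?T" "(x, y, z) \<in> hnf_offdiag (int p) (int q) (int r)" by auto
      have L: "ideal3 (hnf_lattice (int p) (int q) (int r) (x, y, z))"
        using T[OF S(1)] S(2) by (simp add: ideal3_hnf_lattice hnf_offdiag_def)
      show "I \<in> {I. ideal I ZGQ21 \<and> order (ZGQ21 Quot I) = n}"
        using ideal_elt_image[OF L] order_Quot_hnf_lattice[OF L] T[OF S(1)] S(1) by (simp add: I)
    next
      fix I assume "I \<in> {I. ideal I ZGQ21 \<and> order (ZGQ21 Quot I) = n}"
      then have id: "ideal I ZGQ21" and ord: "order (ZGQ21 Quot I) = n" by auto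
      define L where "L = elt -` I"
      have L: "ideal3 L" unfolding L_def by (rule ideal3_vimage[OF id])
      have I: "I = elt ` L" unfolding L_def by (rule ideal_eq_elt_image[OF id])
      have sub: "subgroup3 L" using L by (simp add: ideal3_def)
      \<comment> \<open>An infinite quotient would have order 0, but \<open>n > 0\<close>.\<close>
      have fin: "finite (carrier (ZGQ21 Quot (elt ` L)))"
        using ord assms by (auto simp: order_def I intro: card_ge_0_finite)
      obtain n1 where n1: "n1 \<noteq> 0" "(n1, 0, 0) \<in> L" using finite_index_multiple[OF L fin, of 1 0 0] by auto
      obtain n2 where n2: "n2 \<noteq> 0" "(0, n2, 0) \<in> L" using finite_index_multiple[OF L fin, of 0 1 0] by auto
      obtain n3 where n3: "n3 \<noteq> 0" "(0, 0, n3) \<in> L" using finite_index_multiple[OF L fin, of 0 0 1] by auto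
      define N where "N = n1 * n2 * n3"
      have N: "N \<noteq> 0" "(N, 0, 0) \<in> L" "(0, N, 0) \<in> L" "(0, 0, N) \<in> L"
        using n1(1) n2(1) n3(1) subgroup3_mult[OF sub n1(2), of "n2 * n3"] subgroup3_mult[OF sub n2(2), of "n1 * n3"]
          subgroup3_mult[OF sub n3(2), of "n1 * n2"]
        by (simp_all add: N_def mult_ac)
      from hnf_lattice_exists[OF sub N] obtain p q r x y z where
        pos: "p > 0" "q > 0" "r > 0" and red: "0 \<le> x" "x < q" "0 \<le> y" "y < r" "0 \<le> z" "z < r"
        and Leq: "L = hnf_lattice p q r (x, y, z)" .
      have "((nat p, nat q, nat r), (x, y, z)) \<in> ?S"
        using ord order_Quot_hnf_lattice[OF L[unfolded Leq] pos] L pos red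
        by (simp add: I Leq ideal3_hnf_lattice hnf_offdiag_def)
      moreover have "I = ?f ((nat p, nat q, nat r), (x, y, z))" using pos by (simp add: I Leq)
      ultimately show "I \<in> ?f ` ?S" by blast
    qed
  qed
  then have "ideal_count ZGQ21 n = card ?S" unfolding ideal_count_def by (rule bij_betw_same_card[symmetric])
  also have "\<dots> = (\<Sum>t\<in>?T. card (case t of (p, q, r) \<Rightarrow> hnf_offdiag (int p) (int q) (int r)))"
  proof (rule card_SigmaI)
    show "finite ?T" by (rule finite_factor_triples[OF assms])
    show "\<forall>t\<in>?T. finite (case t of (p, q, r) \<Rightarrow> hnf_offdiag (int p) (int q) (int r))"
    proof
      fix t assume "t \<in> ?T"
      moreover obtain p q r where t: "t = (p, q, r)" by (metis prod_cases3)
      ultimately show "finite (case t of (p, q, r) \<Rightarrow> hnf_offdiag (int p) (int q) (int r))"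
        using T[of p q r] card_hnf_offdiag_sum(1)[of "int q" "int r" "int p"] by simp
    qed
  qed
  also have "\<dots> = (\<Sum>(p, q, r)\<in>?T. card (hnf_offdiag (int p) (int q) (int r)))"
    by (intro sum.cong refl) auto
  finally show ?thesis .
qed

section \<open>Dirichlet series\<close>

text \<open>For complex families summability is absolute, so the product family is absolutely
  summable and may be summed iteratively.\<close>

lemma has_sum_product_complex:
  fixes f :: "'a \<Rightarrow> complex" and g :: "'b \<Rightarrow> complex"
  assumes f: "(f has_sum a) A" and g: "(g has_sum b) B"
  shows "((\<lambda>(x, y). f x * g y) has_sum a * b) (A \<times> B)"
proof (rule has_sum_SigmaI)
  show "((\<lambda>y. case (x, y) of (x, y) \<Rightarrow> f x * g y) has_sum f x * b) B" for x
    using has_sum_cmult_right[OF g] by simp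
  show "((\<lambda>x. f x * b) has_sum a * b) A" using has_sum_cmult_left[OF f] .
  have abs: "(\<lambda>x. norm (f x)) summable_on A" "(\<lambda>y. norm (g y)) summable_on B"
    using f g summable_on_iff_abs_summable_on_complex unfolding summable_on_def by blast+
  have "(\<lambda>z. norm (case z of (x, y) \<Rightarrow> f x * g y)) summable_on A \<times> B"
  proof (rule summable_on_SigmaI)
    show "((\<lambda>y. norm (case (x, y) of (x, y) \<Rightarrow> f x * g y)) has_sum norm (f x) * (\<Sum>\<^sub>\<infinity>y\<in>B. norm (g y))) B" for x
      using has_sum_cmult_right[OF has_sum_infsum[OF abs(2)]] by (simp add: norm_mult)
    show "(\<lambda>x. norm (f x) * (\<Sum>\<^sub>\<infinity>y\<in>B. norm (g y))) summable_on A"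
      using abs(1) by (rule summable_on_cmult_left)
  qed simp
  then show "(\<lambda>(x, y). f x * g y) summable_on A \<times> B" by (rule abs_summable_summable)
qed

lemma riemann_zeta_has_sum:
  assumes "Re s > 1"
  shows "((\<lambda>n. of_nat n powr (- s)) has_sum riemann_zeta s) {1..}"
proof -
  have "summable (\<lambda>n. norm (exp (of_real (ln (of_nat n)) * (- s))))"
    using assms by (subst abs_summable_complex_powr_iff) simp
  then have "summable (\<lambda>n. norm (exp (of_real (ln (of_nat (Suc n))) * (- s))))" by (subst summable_Suc_iff)
  then have *: "summable (\<lambda>n. norm (of_nat (Suc n) powr (- s)))"
    by (simp add: powr_def mult.commute Ln_of_nat del: of_nat_Suc)
  have "((\<lambda>n. of_nat (Suc n) powr (- s)) has_sum riemann_zeta s) UNIV"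
    unfolding riemann_zeta_def
    by (intro norm_summable_imp_has_sum * summable_sums summable_norm_cancel[OF *])
  then have "((\<lambda>n. of_nat n powr (- s)) has_sum riemann_zeta s) (range Suc)"
    by (subst has_sum_reindex) (simp_all add: o_def)
  moreover have "range Suc = {1..}" by (auto simp: image_iff Suc_le_eq gr0_conv_Suc)
  ultimately show ?thesis by simp
qed

text \<open>Substitute \<open>d * n\<close> for \<open>n\<close> in the zeta series; the indicator
  extends the sum over multiples of \<open>d\<close> by zeros.\<close>

lemma has_sum_dvd_powr:
  assumes "Re s > 1" "d > 0"
  shows "((\<lambda>n. of_bool (d dvd n) * of_nat n powr (- s)) has_sum of_nat d powr (- s) * riemann_zeta s) {1..}"
proof -
  have "((\<lambda>n. of_nat d powr (- s) * of_nat n powr (- s)) has_sum of_nat d powr (- s) * riemann_zeta s) {1..}"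
    by (intro has_sum_cmult_right riemann_zeta_has_sum assms)
  then have "((\<lambda>n. of_nat (d * n) powr (- s)) has_sum of_nat d powr (- s) * riemann_zeta s) {1..}"
    by (simp add: powr_times_real_left)
  then have "((\<lambda>n. of_nat n powr (- s)) has_sum of_nat d powr (- s) * riemann_zeta s) ((*) d ` {1..})"
    using assms(2) by (subst has_sum_reindex) (simp_all add: inj_on_def o_def)
  also have "?this \<longleftrightarrow> ((\<lambda>n. of_bool (d dvd n) * of_nat n powr (- s)) has_sum of_nat d powr (- s) * riemann_zeta s) {1..}"
    using assms(2) by (intro has_sum_cong_neutral) (auto elim!: dvdE)
  finally show ?thesis .
qed

section \<open>The Dirichlet series of the ideal counts\<close>

definition dvd_ind :: "nat \<Rightarrow> nat \<Rightarrow> complex" (\<open>\<delta>\<close>) where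
  "\<delta> d n = of_bool (d dvd n)"

text \<open>One summand for each nonzero branch of \<open>card_hnf_offdiag\<close>. As 9 dividing
  \<open>n\<close> implies 3 dividing \<open>n\<close>, the difference
  \<open>\<delta> 3 n - \<delta> 9 n\<close> detects divisibility by 3 but not by 9. In this form
  every summand is a product of functions of \<open>p\<close>, \<open>q\<close> and
  \<open>r\<close>.\<close>

lemma card_hnf_offdiag_indicators:
  fixes p q r :: nat
  assumes "q > 0" "r > 0"
  shows "of_nat (card (hnf_offdiag (int p) (int q) (int r))) =
    (\<delta> 1 p * (\<delta> 1 q - \<delta> 3 q) * (\<delta> 1 r - \<delta> 3 r)
    + 3 * (\<delta> 3 p * \<delta> 3 q * (\<delta> 1 r - \<delta> 3 r))
    + 15 * (\<delta> 9 p * \<delta> 3 q * (\<delta> 3 r - \<delta> 9 r))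
    + 6 * ((\<delta> 3 p - \<delta> 9 p) * \<delta> 3 q * (\<delta> 3 r - \<delta> 9 r))
    + 9 * (\<delta> 3 p * (\<delta> 3 q - \<delta> 9 q) * \<delta> 9 r)
    + 27 * (\<delta> 9 p * \<delta> 9 q * \<delta> 9 r))"
proof -
  have int: "3 dvd int n \<longleftrightarrow> 3 dvd n" "9 dvd int n \<longleftrightarrow> 9 dvd n" for n
    using int_dvd_int_iff[of 3 n] int_dvd_int_iff[of 9 n] by simp_all
  have 39: "3 dvd n" if "9 dvd n" for n :: nat using that by presburger
  have "int q > 0" "int r > 0" using assms by simp_all
  note card = card_hnf_offdiag[OF this, of "int p", unfolded int]
  show ?thesis unfolding card dvd_ind_def
    using 39[of p] 39[of q] 39[of r]
    by (cases "9 dvd p"; cases "3 dvd p"; cases "9 dvd q"; cases "3 dvd q"; cases "9 dvd r"; cases "3 dvd r") simp_all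
qed

text \<open>The function \<open>n powr (- s)\<close> is completely multiplicative on the naturals,
  so the triple series splits into three factors.\<close>

lemma has_sum_dirichlet_triple:
  fixes s :: complex and u v w :: "nat \<Rightarrow> complex"
  assumes "((\<lambda>n. u n * of_nat n powr (- s)) has_sum a) A"
    and "((\<lambda>n. v n * of_nat n powr (- s)) has_sum b) B"
    and "((\<lambda>n. w n * of_nat n powr (- s)) has_sum c) C"
  shows "((\<lambda>(p, q, r). u p * v q * w r * of_nat (p * q * r) powr (- s)) has_sum a * b * c) (A \<times> B \<times> C)"
proof -
  have "((\<lambda>(p, q, r). (u p * of_nat p powr (- s)) * ((v q * of_nat q powr (- s)) * (w r * of_nat r powr (- s))))
      has_sum a * (b * c)) (A \<times> B \<times> C)"
    using has_sum_product_complex[OF assms(1) has_sum_product_complex[OF assms(2,3)]]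
    by (simp add: case_prod_unfold)
  moreover have "of_nat (p * q * r) powr (- s) = of_nat p powr (- s) * of_nat q powr (- s) * of_nat r powr (- s)"
    for p q r by (simp add: powr_times_real_left)
  ultimately show ?thesis by (simp add: case_prod_unfold mult_ac del: of_nat_mult)
qed

lemma has_sum_diff_complex:
  fixes f g :: "'a \<Rightarrow> complex"
  assumes "(f has_sum a) A" "(g has_sum b) A"
  shows "((\<lambda>x. f x - g x) has_sum (a - b)) A"
  using has_sum_add[OF assms(1) has_sum_cmult_right[OF assms(2), of "- 1"]] by simp

lemma has_sum_hnf_offdiag:
  fixes s :: complex
  assumes "Re s > 1"
  defines "t \<equiv> 3 powr (- s)"
  shows "((\<lambda>(p, q, r). of_nat (card (hnf_offdiag (int p) (int q) (int r))) * of_nat (p * q * r) powr (- s))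
    has_sum (27 * t ^ 6 - 18 * t ^ 5 + 12 * t ^ 4 + 3 * t ^ 3 + 4 * t ^ 2 - 2 * t + 1) * riemann_zeta s ^ 3)
    ({1..} \<times> {1..} \<times> {1..})"
proof -
  define Z where "Z = riemann_zeta s"
  have 9: "9 powr (- s) = t ^ 2"
    using powr_times_real_left[of 3 3 "- s"] by (simp add: t_def power2_eq_square)
  have d1: "((\<lambda>n. \<delta> 1 n * of_nat n powr (- s)) has_sum Z) {1..}"
    using has_sum_dvd_powr[OF assms(1), of 1] by (simp add: dvd_ind_def Z_def)
  have d3: "((\<lambda>n. \<delta> 3 n * of_nat n powr (- s)) has_sum t * Z) {1..}"
    using has_sum_dvd_powr[OF assms(1), of 3] by (simp add: dvd_ind_def Z_def t_def)
  have d9: "((\<lambda>n. \<delta> 9 n * of_nat n powr (- s)) has_sum t ^ 2 * Z) {1..}"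
    using has_sum_dvd_powr[OF assms(1), of 9] by (simp add: dvd_ind_def Z_def 9)
  have u1: "((\<lambda>n. (\<delta> 1 n - \<delta> 3 n) * of_nat n powr (- s)) has_sum Z - t * Z) {1..}"
    unfolding left_diff_distrib by (rule has_sum_diff_complex[OF d1 d3])
  have u3: "((\<lambda>n. (\<delta> 3 n - \<delta> 9 n) * of_nat n powr (- s)) has_sum t * Z - t ^ 2 * Z) {1..}"
    unfolding left_diff_distrib by (rule has_sum_diff_complex[OF d3 d9])
  \<comment> \<open>The six series follow the six indicator summands; \<open>\<delta> 1\<close>,
    \<open>\<delta> 3\<close>, \<open>\<delta> 9\<close> contribute \<open>Z\<close>,
    \<open>t * Z\<close>, \<open>t ^ 2 * Z\<close>.\<close>
  note has_sum_add[OF has_sum_add[OF has_sum_add[OF has_sum_add[OF has_sum_add[OF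
    has_sum_dirichlet_triple[OF d1 u1 u1]
    has_sum_cmult_right[OF has_sum_dirichlet_triple[OF d3 d3 u1], of 3]]
    has_sum_cmult_right[OF has_sum_dirichlet_triple[OF d9 d3 u3], of 15]]
    has_sum_cmult_right[OF has_sum_dirichlet_triple[OF u3 d3 u3], of 6]]
    has_sum_cmult_right[OF has_sum_dirichlet_triple[OF d3 u3 d9], of 9]]
    has_sum_cmult_right[OF has_sum_dirichlet_triple[OF d9 d9 d9], of 27]]
  also have "Z * (Z - t * Z) * (Z - t * Z) + 3 * (t * Z * (t * Z) * (Z - t * Z))
      + 15 * (t ^ 2 * Z * (t * Z) * (t * Z - t ^ 2 * Z))
      + 6 * ((t * Z - t ^ 2 * Z) * (t * Z) * (t * Z - t ^ 2 * Z))
      + 9 * (t * Z * (t * Z - t ^ 2 * Z) * (t ^ 2 * Z)) + 27 * (t ^ 2 * Z * (t ^ 2 * Z) * (t ^ 2 * Z)) =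
      (27 * t ^ 6 - 18 * t ^ 5 + 12 * t ^ 4 + 3 * t ^ 3 + 4 * t ^ 2 - 2 * t + 1) * Z ^ 3"
    by (simp add: algebra_simps eval_nat_numeral)
  finally show ?thesis unfolding Z_def
    by (rule has_sum_cong[THEN iffD1, rotated], elim SigmaE,
        simp only: atLeast_iff One_nat_def Suc_le_eq prod.case card_hnf_offdiag_indicators distrib_right mult.assoc)
qed

text \<open>Triples are regrouped by their product, with finite fibres. Index \<open>n\<close>
  stands for the product \<open>Suc n\<close>, in line with \<open>solomon_term\<close>; hence the
  \<open>- 1\<close> in the witness below.\<close>

lemma has_sum_multiplicative_fibres:
  fixes f :: "nat \<times> nat \<times> nat \<Rightarrow> complex"
  assumes "(f has_sum a) ({1..} \<times> {1..} \<times> {1..})"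
  shows "((\<lambda>n. \<Sum>x | (case x of (p, q, r) \<Rightarrow> p * q * r = Suc n). f x) has_sum a) UNIV"
proof -
  let ?T = "\<lambda>n. {(p, q, r). p * q * r = Suc n}"
  have "((\<lambda>x. f (snd x)) has_sum a) (Sigma UNIV ?T)"
  proof (rule has_sum_reindex_bij_witness[where S = "{1..} \<times> {1..} \<times> {1..}" and g = f and h = "\<lambda>x. f (snd x)"
        and i = snd and j = "\<lambda>(p, q, r). (p * q * r - 1, p, q, r)", THEN iffD1, OF _ _ _ _ _ refl assms])
    show "snd x \<in> {1..} \<times> {1..} \<times> {1..}" if "x \<in> Sigma UNIV ?T" for x
    proof -
      obtain n p q r where x: "x = (n, p, q, r)" by (metis prod_cases4)
      with that have "p * q * r \<noteq> 0" by simp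
      then show ?thesis unfolding x by simp
    qed
  qed auto
  moreover have "((\<lambda>x. f (snd (n, x))) has_sum (\<Sum>x\<in>?T n. f x)) (?T n)" for n
    using finite_factor_triples[of "Suc n"] by (simp add: has_sum_finite)
  ultimately show ?thesis by (intro has_sum_Sigma'[where A = UNIV and B = ?T]) auto
qed

theorem theorem4p3:
  fixes s :: complex
  assumes "Re s > 1"
  shows "summable (solomon_term ZGQ21 s)
    \<and> solomon_zeta ZGQ21 s =
        (3 powr (3 - 6 * s) - 2 * 3 powr (2 - 5 * s) + 4 * 3 powr (1 - 4 * s)
          + 3 powr (1 - 3 * s) + 4 * 3 powr (- 2 * s) - 2 * 3 powr (- s) + 1)
        * riemann_zeta s ^ 3"
proof -
  define t :: complex where "t = 3 powr (- s)"
  have pow: "3 powr (of_nat a - of_nat n * s) = 3 ^ a * t ^ n" for a n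
  proof -
    have "3 powr (of_nat a - of_nat n * s) = exp (of_nat a * ln 3) * exp (of_nat n * (- s * ln 3))"
      by (simp add: powr_def exp_add[symmetric] algebra_simps)
    then show ?thesis unfolding exp_of_nat_mult by (simp add: t_def powr_def)
  qed
  \<comment> \<open>The powers of 3 merge with the coefficients of the claim:
    \<open>2 * 9 = 18\<close> and \<open>4 * 3 = 12\<close> match the polynomial in
    \<open>t\<close>.\<close>
  have coeff: "3 powr (3 - 6 * s) = 27 * t ^ 6" "3 powr (2 - 5 * s) = 9 * t ^ 5" "3 powr (1 - 4 * s) = 3 * t ^ 4"
    "3 powr (1 - 3 * s) = 3 * t ^ 3" "3 powr (- 2 * s) = t ^ 2"
    using pow[of 3 6] pow[of 2 5] pow[of 1 4] pow[of 1 3] pow[of 0 2] by simp_all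
  have "solomon_term ZGQ21 s = (\<lambda>n. \<Sum>x | (case x of (p, q, r) \<Rightarrow> p * q * r = Suc n).
      case x of (p, q, r) \<Rightarrow> of_nat (card (hnf_offdiag (int p) (int q) (int r))) * of_nat (p * q * r) powr (- s))"
    by (rule ext) (auto simp: solomon_term_def ideal_count_ZGQ21 sum_distrib_right simp del: of_nat_Suc of_nat_mult intro!: sum.cong)
  then have "(solomon_term ZGQ21 s has_sum
      (27 * t ^ 6 - 18 * t ^ 5 + 12 * t ^ 4 + 3 * t ^ 3 + 4 * t ^ 2 - 2 * t + 1) * riemann_zeta s ^ 3) UNIV"
    using has_sum_multiplicative_fibres[OF has_sum_hnf_offdiag[OF assms]] by (simp only: t_def)
  then have "solomon_term ZGQ21 s sums
      ((27 * t ^ 6 - 18 * t ^ 5 + 12 * t ^ 4 + 3 * t ^ 3 + 4 * t ^ 2 - 2 * t + 1) * riemann_zeta s ^ 3)"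
    by (rule has_sum_imp_sums)
  then show ?thesis unfolding solomon_zeta_def coeff t_def[symmetric]
    by (auto simp: sums_iff)
qed

end
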